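(* Consider the semiparametric paired-comparison model described in the context and suppose that Conditions C1--C4 listed there hold. If $\gamma_0^*=1$ and $\theta_0^*=0$, then $$\boldsymbol\theta^*=V^{-1}U^\top\,\mathbb E(\overline Y-\overline Z\boldsymbol\eta^* ),\qquad \boldsymbol\eta^*=\big[\mathbb E(\overline Z^\top D\overline Z)\big]^{-1}\mathbb E(\overline Z^\top D\overline Y),$$ where $\boldsymbol\theta^*=(\theta_1^*,\dots,\theta_n^* )^\top$ (excluding $\theta_0^*$).
   Context: **Model.** There are $n+1$ items $0,1,\dots,n$; each pair is compared $T$ times, $T$ a fixed positive integer. For $0\le i\ne j\le n$ and $t\in\{1,\dots,T\}$, $X_{ijt}=(X_{ijt,0},X_{ijt,1},\dots,X_{ijt,p})^\top$ is a random covariate vector ($p$ fixed) with $X_{ijt}=-X_{jit}$; write $Z_{ijt}=(X_{ijt,1},\dots,X_{ijt,p})^\top$. For $i<j$ the outcome is $$a_{ijt}=\mathbb I(\theta_i^*-\theta_j^*+X_{ijt}^\top\gamma^*>\varepsilon_{ijt}),$$ with true merit parameters $\theta_i^*$, true coefficient $\gamma^*=(\gamma_0^*,\dots,\gamma_p^* )^\top$, $\boldsymbol\eta^*=(\gamma_1^*,\dots,\gamma_p^* )^\top$, and latent noise $\varepsilon_{ijt}$ with unspecified cumulative distribution function $F$ satisfying $F(x)+F(-x)=1$. The $a_{ijt}$ ($0\le i<j\le n$, $1\le t\le T$) are conditionally independent given all the covariates. **Matrices.** $N=n(n+1)/2$; pairs $i<j$ are ordered $01,\dots,0n,12,\dots,1n,\dots,(n-1)n$.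 $\overline Z\in\mathbb R^{N\times p}$ has rows $\overline Z_{ij}^\top$, $\overline Z_{ij}=T^{-1}\sum_{t=1}^T Z_{ijt}$. $U\in\mathbb R^{N\times n}$ has rows $(e_i-e_j)^\top$, $e_1,\dots,e_n$ being the standard basis of $\mathbb R^n$ and $e_0=0$. $V=U^\top U=(n+1)I_n-\mathbf 1_n\mathbf 1_n^\top$ and $D=I_N-UV^{-1}U^\top$. **Transformed outcome.** $Y_{ijt}=\{a_{ijt}-\mathbb I(X_{ijt,0}>0)\}/f(X_{ijt,0}|Z_{ijt})$ with $f(\cdot|Z_{ijt})$ as in C1, $\overline Y_{ij}=T^{-1}\sum_{t=1}^TY_{ijt}$, $\overline Y=(\overline Y_{ij})_{i<j}\in\mathbb R^N$. **Conditions.** C1. The covariate $X_{ijt,0}$ is continuous with $\gamma_0^*>0$, and its conditional distribution given $Z_{ijt}$ is absolutely continuous with respect to Lebesgue measure with nondegenerate conditional density $f(x|Z_{ijt})$. C2. $f(x|Z_{ijt})$ has support $(-B_U,B_U)$, where $B_U>0$, and the support of $-(\theta_i^*-\theta_j^*+Z_{ijt}^\top\boldsymbol\eta^*-\varepsilon_{ijt})/\gamma_0^*$ is a subset of $(-B_U,B_U)$. C3. $\varepsilon_{ijt}$ is independent of $X_{ijt}$, $\varepsilon_{ijt}=-\varepsilon_{jit}$, and $\mathbb E(\varepsilon_{ijt})=0$ ($0\le i<j\le n$, $1\le t\le T$). C4. There is a constant $\lambda>0$ with $\lambda_{\min}(\overline Z^\top D\overline Z/N)\ge\lambda$ almost 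surely.
   Formalization: The formula for η* is proved under two added assumptions, as it fails from C1–C4 alone: the conditional law of (X_{ijt,0}, ε_{ijt}) given all the Z's depends only on Z_{ijt}, and Z̄ᵀDZ̄ is integrable. The formula for θ* needs neither. *)

theory Defs
  imports "HOL-Probability.Probability" "HOL-Library.Option_ord"
begin

section \<open>Conditioning\<close>

definition generated_algebra ::
  "'a measure \<Rightarrow> 'c set \<Rightarrow> ('c \<Rightarrow> 'a \<Rightarrow> 'b::topological_space) \<Rightarrow> 'a measure" where
  "generated_algebra M I W =
     vimage_algebra (space M) (\<lambda>\<omega>. \<lambda>c\<in>I. W c \<omega>) (\<Pi>\<^sub>M c\<in>I. borel)"

definition cond_indep_vars ::
  "'a measure \<Rightarrow> 'a measure \<Rightarrow> 'b measure \<Rightarrow> ('c \<Rightarrow> 'a \<Rightarrow> 'b) \<Rightarrow> 'c set \<Rightarrow> bool" where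
  "cond_indep_vars M G N W I \<longleftrightarrow>
     (\<forall>c\<in>I. W c \<in> measurable M N) \<and>
     (\<forall>J A. J \<subseteq> I \<longrightarrow> finite J \<longrightarrow> A \<in> J \<rightarrow> sets N \<longrightarrow>
        (AE \<omega> in M. real_cond_exp M G (\<lambda>\<omega>. \<Prod>c\<in>J. indicat_real (A c) (W c \<omega>)) \<omega>
                  = (\<Prod>c\<in>J. real_cond_exp M G (\<lambda>\<omega>. indicat_real (A c) (W c \<omega>)) \<omega>)))"

text \<open>The conditional distribution of \<open>W\<close> given \<open>Z\<close> is \<open>A \<mapsto> \<integral>\<^sub>A f(x | Z) dx\<close>. Taking \<open>A = UNIV\<close> shows
  that \<open>f(\<cdot> | Z)\<close> almost surely integrates to \<open>1\<close>.\<close>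

definition cond_density ::
  "'a measure \<Rightarrow> ('a \<Rightarrow> real) \<Rightarrow> ('a \<Rightarrow> 'b) \<Rightarrow> 'b measure \<Rightarrow> (real \<Rightarrow> 'b \<Rightarrow> real) \<Rightarrow> bool" where
  "cond_density M W Z N f \<longleftrightarrow>
     W \<in> borel_measurable M \<and> Z \<in> measurable M N \<and>
     (\<lambda>(x, z). f x z) \<in> borel_measurable (borel \<Otimes>\<^sub>M N) \<and> (\<forall>x z. 0 \<le> f x z) \<and>
     (\<forall>A\<in>sets borel. AE \<omega> in M.
        real_cond_exp M (vimage_algebra (space M) Z N) (\<lambda>\<omega>. indicat_real A (W \<omega>)) \<omega>
          = (LINT x:A|lborel. f x (Z \<omega>)))"

text \<open>\<open>W\<close> is conditionally independent of \<open>G\<close> given a sub-\<open>\<sigma>\<close>-algebra \<open>H\<close> of \<open>G\<close>: the conditional law of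
  \<open>W\<close> given \<open>G\<close> is already its conditional law given \<open>H\<close>.\<close>

definition cond_law_reduces ::
  "'a measure \<Rightarrow> 'a measure \<Rightarrow> 'a measure \<Rightarrow> ('a \<Rightarrow> 'b) \<Rightarrow> 'b measure \<Rightarrow> bool" where
  "cond_law_reduces M G H W N \<longleftrightarrow>
     (\<forall>A\<in>sets N. AE \<omega> in M. real_cond_exp M G (\<lambda>\<omega>. indicat_real A (W \<omega>)) \<omega>
                          = real_cond_exp M H (\<lambda>\<omega>. indicat_real A (W \<omega>)) \<omega>)"

section \<open>Matrices\<close>

text \<open>For symmetric \<open>A\<close> the set of real eigenvalues is finite and nonempty.\<close>

definition eigenvalues :: "real^'p^'p \<Rightarrow> real set" where
  "eigenvalues A = {k. \<exists>v. v \<noteq> 0 \<and> A *v v = k *\<^sub>R v}"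

definition lambda_min :: "real^'p^'p \<Rightarrow> real" where
  "lambda_min A = Min (eigenvalues A)"

text \<open>The \<open>n + 1\<close> items are the elements of \<open>'n option\<close> with \<open>n = CARD('n)\<close>: \<open>None\<close> is item \<open>0\<close>, and it lies
  below every \<open>Some i\<close>. The elements of \<open>'n pairs\<close> index the rows of the \<open>N \<times> n\<close> and \<open>N \<times> p\<close> matrices.\<close>

typedef (overloaded) 'n pairs = "{(i, j). i < (j :: 'n::linorder option)}"
  by (rule exI[of _ "(None, Some undefined)"]) simp

instance pairs :: ("{finite, linorder}") finite
proof
  have "range (Rep_pairs :: 'a pairs \<Rightarrow> _) \<subseteq> UNIV" by simp
  then show "finite (UNIV :: 'a pairs set)"
    by (metis finite finite_imageD inj_on_def Rep_pairs_inject)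
qed

definition lo :: "'n::linorder pairs \<Rightarrow> 'n option" where "lo e = fst (Rep_pairs e)"
definition hi :: "'n::linorder pairs \<Rightarrow> 'n option" where "hi e = snd (Rep_pairs e)"

definition unit_vec :: "'n::finite option \<Rightarrow> real^'n" where
  "unit_vec i = (case i of None \<Rightarrow> 0 | Some k \<Rightarrow> axis k 1)"

definition U_mat :: "real^('n::{finite,linorder})^('n::{finite,linorder} pairs)" where
  "U_mat = (\<chi> e. unit_vec (lo e) - unit_vec (hi e))"

definition V_mat :: "real^('n::{finite,linorder})^('n::{finite,linorder})" where
  "V_mat = transpose U_mat ** U_mat"

definition D_mat :: "real^('n::{finite,linorder} pairs)^('n::{finite,linorder} pairs)" where
  "D_mat = mat 1 - U_mat ** matrix_inv V_mat ** transpose U_mat"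

lemma lo_less_hi: "lo e < hi e"
  using Rep_pairs[of e] by (auto simp: lo_def hi_def)

lemma sum_pairs:
  fixes g :: "'n::{finite,linorder} option \<Rightarrow> 'n option \<Rightarrow> 'b::comm_monoid_add"
  shows "(\<Sum>e\<in>UNIV. g (lo e) (hi e)) = (\<Sum>(i, j)\<in>{(i, j). i < j}. g i j)"
proof -
  have "bij_betw Rep_pairs (UNIV :: 'n pairs set) {(i, j). i < j}"
    by (simp add: bij_betw_def inj_on_def Rep_pairs_inject
        type_definition.Rep_range[OF type_definition_pairs])
  then have "(\<Sum>e\<in>UNIV. (\<lambda>(i, j). g i j) (Rep_pairs e)) = (\<Sum>(i, j)\<in>{(i, j). i < j}. g i j)"
    by (rule sum.reindex_bij_betw)
  then show ?thesis
    by (simp add: lo_def hi_def split_def)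
qed

lemma sum_pairs_symmetric:
  fixes g :: "'n::{finite,linorder} option \<Rightarrow> 'n option \<Rightarrow> real"
  assumes "\<And>i j. g i j = g j i" and "\<And>i. g i i = 0"
  shows "2 * (\<Sum>e\<in>UNIV. g (lo e) (hi e)) = (\<Sum>i\<in>UNIV. \<Sum>j\<in>UNIV. g i j)"
proof -
  let ?L = "{(i, j). i < (j :: 'n option)}" and ?G = "{(i, j). j < (i :: 'n option)}"
    and ?E = "{(i, j). i = (j :: 'n option)}"
  have "(\<Sum>i\<in>UNIV. \<Sum>j\<in>UNIV. g i j) = (\<Sum>(i, j)\<in>UNIV \<times> UNIV. g i j)"
    by (simp add: sum.cartesian_product)
  also have "UNIV \<times> UNIV = (?L \<union> ?G) \<union> ?E" by auto
  also have "(\<Sum>(i, j)\<in>(?L \<union> ?G) \<union> ?E. g i j)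
      = ((\<Sum>(i, j)\<in>?L. g i j) + (\<Sum>(i, j)\<in>?G. g i j)) + (\<Sum>(i, j)\<in>?E. g i j)"
    by (subst sum.union_disjoint; (subst sum.union_disjoint)?) auto
  also have "(\<Sum>(i, j)\<in>?E. g i j) = 0" by (rule sum.neutral) (auto simp: assms)
  also have "(\<Sum>(i, j)\<in>?G. g i j) = (\<Sum>(i, j)\<in>?L. g i j)"
    by (rule sum.reindex_bij_witness[of _ prod.swap prod.swap]) (auto simp: assms(1))
  finally show ?thesis by (simp add: sum_pairs)
qed

lemma card_pairs: "CARD('n::{finite,linorder} pairs) = CARD('n) * (CARD('n) + 1) div 2"
proof -
  have "2 * (\<Sum>e\<in>(UNIV :: 'n pairs set). of_bool (lo e \<noteq> hi e))
      = (\<Sum>i\<in>UNIV. \<Sum>j\<in>(UNIV :: 'n option set). of_bool (i \<noteq> j) :: real)"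
    by (rule sum_pairs_symmetric) auto
  moreover have "(\<Sum>e\<in>(UNIV :: 'n pairs set). of_bool (lo e \<noteq> hi e)) = real CARD('n pairs)"
    by (simp add: less_imp_neq[OF lo_less_hi])
  moreover have "(\<Sum>j\<in>(UNIV :: 'n option set). of_bool (i \<noteq> j) :: real) = real CARD('n)" for i
  proof -
    have "(\<Sum>j\<in>(UNIV :: 'n option set). of_bool (i \<noteq> j) :: real) = real (card (UNIV - {i}))"
      by (subst sum.mono_neutral_right[of UNIV "UNIV - {i}"]) auto
    then show ?thesis by (simp add: card_Diff_singleton card_UNIV_option)
  qed
  ultimately have "real (2 * CARD('n pairs)) = real (CARD('n) * (CARD('n) + 1))"
    by (simp add: card_UNIV_option algebra_simps)
  then have "2 * CARD('n pairs) = CARD('n) * (CARD('n) + 1)" by (simp only: of_nat_eq_iff)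
  then show ?thesis by linarith
qed

lemma sum_differences_product:
  fixes a b :: "'i::finite \<Rightarrow> real"
  shows "(\<Sum>i\<in>UNIV. \<Sum>j\<in>UNIV. (a i - a j) * (b i - b j))
    = 2 * (real CARD('i) * (\<Sum>i\<in>UNIV. a i * b i) - (\<Sum>i\<in>UNIV. a i) * (\<Sum>i\<in>UNIV. b i))"
proof -
  have inner: "(\<Sum>j\<in>UNIV. (a i - a j) * (b i - b j))
      = real CARD('i) * (a i * b i) + (\<Sum>j\<in>UNIV. a j * b j)
        - a i * (\<Sum>j\<in>UNIV. b j) - b i * (\<Sum>j\<in>UNIV. a j)" for i
    by (simp add: algebra_simps sum.distrib sum_subtractf sum_distrib_left)
  show ?thesis
    unfolding inner
    by (simp add: sum.distrib sum_subtractf sum_distrib_left[symmetric] sum_distrib_right[symmetric]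
        right_diff_distrib mult.commute)
qed

lemma V_mat_eq:
  "(V_mat :: real^('n::{finite,linorder})^('n::{finite,linorder}))
     = mat (real CARD('n) + 1) - (\<chi> k l. 1)"
proof -
  have "V_mat $ k $ l = (mat (real CARD('n) + 1) - (\<chi> k l. 1)) $ k $ l" for k l :: 'n
  proof -
    let ?a = "\<lambda>(k :: 'n) i. of_bool (i = Some k) :: real"
    have u: "unit_vec i $ k = ?a k i" for i and k :: 'n
      by (cases i) (auto simp: unit_vec_def axis_def)
    have sa: "(\<Sum>i\<in>UNIV. ?a k i) = 1" "(\<Sum>i\<in>UNIV. ?a k i * ?a l i) = of_bool (k = l)"
      for k l :: 'n
    proof -
      have "(\<Sum>i\<in>UNIV. ?a k i) = (\<Sum>i\<in>UNIV. if i = Some k then 1 else 0)"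
        by (rule sum.cong) auto
      then show "(\<Sum>i\<in>UNIV. ?a k i) = 1" by simp
      have "(\<Sum>i\<in>UNIV. ?a k i * ?a l i)
          = (\<Sum>i\<in>UNIV. if i = Some k then of_bool (k = l) else 0)"
        by (rule sum.cong) auto
      then show "(\<Sum>i\<in>UNIV. ?a k i * ?a l i) = of_bool (k = l)" by simp
    qed
    have "2 * V_mat $ k $ l = 2 * (\<Sum>e\<in>UNIV. (?a k (lo e) - ?a k (hi e)) * (?a l (lo e) - ?a l (hi e)))"
      by (simp add: V_mat_def U_mat_def matrix_matrix_mult_def transpose_def u)
    also have "\<dots> = (\<Sum>i\<in>UNIV. \<Sum>j\<in>UNIV. (?a k i - ?a k j) * (?a l i - ?a l j))"
      by (rule sum_pairs_symmetric) (auto simp: algebra_simps)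
    also have "\<dots> = 2 * ((real CARD('n) + 1) * of_bool (k = l) - 1)"
      by (simp add: sum_differences_product sa card_UNIV_option del: of_bool_eq_iff)
    finally show ?thesis by (cases "k = l") (simp_all add: mat_def)
  qed
  then show ?thesis by (simp add: vec_eq_iff)
qed

section \<open>The paired-comparison model\<close>

text \<open>Component \<open>None\<close> of a covariate vector and of \<open>\<gamma>\<close> is the one numbered \<open>0\<close>; the components
  \<open>Some k\<close> make up \<open>Z\<close> and \<open>\<eta>\<close>, with \<open>p = CARD('p)\<close>.\<close>

definition tail :: "real^('p::finite option) \<Rightarrow> real^'p" where
  "tail x = (\<chi> k. x $ Some k)"

definition outcome ::
  "('i \<Rightarrow> real) \<Rightarrow> real^('p::finite option) \<Rightarrow> ('i \<Rightarrow> 'i \<Rightarrow> nat \<Rightarrow> 'a \<Rightarrow> real^('p option)) \<Rightarrow>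
   ('i \<Rightarrow> 'i \<Rightarrow> nat \<Rightarrow> 'a \<Rightarrow> real) \<Rightarrow> 'i \<Rightarrow> 'i \<Rightarrow> nat \<Rightarrow> 'a \<Rightarrow> real" where
  "outcome \<theta> \<gamma> X \<epsilon> i j t \<omega> = of_bool (\<theta> i - \<theta> j + X i j t \<omega> \<bullet> \<gamma> > \<epsilon> i j t \<omega>)"

definition transformed ::
  "('i \<Rightarrow> 'i \<Rightarrow> nat \<Rightarrow> 'a \<Rightarrow> real) \<Rightarrow> ('i \<Rightarrow> 'i \<Rightarrow> nat \<Rightarrow> 'a \<Rightarrow> real^('p::finite option)) \<Rightarrow>
   ('i \<Rightarrow> 'i \<Rightarrow> nat \<Rightarrow> real \<Rightarrow> real^'p \<Rightarrow> real) \<Rightarrow> 'i \<Rightarrow> 'i \<Rightarrow> nat \<Rightarrow> 'a \<Rightarrow> real" where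
  "transformed a X f i j t \<omega> =
     (a i j t \<omega> - of_bool (X i j t \<omega> $ None > 0)) / f i j t (X i j t \<omega> $ None) (tail (X i j t \<omega>))"

definition pair_average ::
  "nat \<Rightarrow> ('n::{finite,linorder} option \<Rightarrow> 'n option \<Rightarrow> nat \<Rightarrow> 'a \<Rightarrow> 'b::real_vector) \<Rightarrow> 'a \<Rightarrow>
   'b^('n pairs)" where
  "pair_average T W \<omega> = (\<chi> e. (1 / real T) *\<^sub>R (\<Sum>t=1..T. W (lo e) (hi e) t \<omega>))"

definition comparisons :: "nat \<Rightarrow> ('i::linorder \<times> 'i \<times> nat) set" where
  "comparisons T = {(i, j, t). i < j \<and> t \<in> {1..T}}"

end

theory Submission
  imports Defs
begin

text \<open>Write \<open>W\<close> for component \<open>0\<close> of the covariate and \<open>m = \<theta>\<^sub>i - \<theta>\<^sub>j + Z \<bullet> \<eta>\<close>, so that the outcome is the indicator of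
  \<open>W > s\<close> with \<open>s = \<epsilon> - m \<in> (-B, B)\<close>. Given \<open>(\<epsilon>, Z)\<close>, the variable \<open>W\<close> still has density \<open>f(\<cdot> | Z)\<close>, so dividing by it
  gives \<open>E(Y | \<epsilon>, Z) = \<integral> (1{x > s} - 1{x > 0}) dx = -s\<close>, hence \<open>E(Y | Z) = m\<close> because \<open>\<epsilon>\<close> is centred and
  independent of \<open>Z\<close>. Averaging, \<open>E(Ybar - Zbar \<eta>) = U \<theta>\<close>, and \<open>V\<^sup>-\<^sup>1 U\<^sup>T\<close> is a left inverse of \<open>U\<close>.

  Under exogeneity the same computation conditions on all of the \<open>Z\<close>'s, so \<open>E(Ybar | Z's) = U \<theta> + Zbar \<eta>\<close>; since
  \<open>D U = 0\<close>, multiplying by \<open>Zbar\<^sup>T D\<close> gives the normal equations. As \<open>D\<close> is an orthogonal projection,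
  \<open>Zbar\<^sup>T D Zbar = R\<^sup>T R\<close> with \<open>R = D Zbar\<close>; its integrability makes the entries of \<open>R\<close> square integrable, which
  justifies the expectations, and C4 makes its mean positive definite.\<close>

section \<open>Conditional law of the first covariate and the noise\<close>

text \<open>Boxes are closed under intersection and generate the triple product, so the pi-lambda
  argument applies. The whole space is itself a box of finite measure, hence a constant exhausting
  sequence suffices.\<close>

lemma finite_measure_eqI_triple:
  assumes "finite_measure P"
    and P: "sets P = sets (A \<Otimes>\<^sub>M (B \<Otimes>\<^sub>M C))" and Q: "sets Q = sets (A \<Otimes>\<^sub>M (B \<Otimes>\<^sub>M C))"
    and eq: "\<And>a b c. a \<in> sets A \<Longrightarrow> b \<in> sets B \<Longrightarrow> c \<in> sets C \<Longrightarrow>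
      emeasure P (a \<times> b \<times> c) = emeasure Q (a \<times> b \<times> c)"
  shows "P = Q"
proof (rule measure_eqI_generator_eq)
  let ?R = "{b \<times> c |b c. b \<in> sets B \<and> c \<in> sets C}"
  let ?E = "{a \<times> d |a d. a \<in> sets A \<and> d \<in> ?R}"
  let ?\<Omega> = "space A \<times> space B \<times> space C"
  show "Int_stable ?E"
    unfolding Int_stable_def
    by (auto simp: Times_Int_Times) (metis Times_Int_Times sets.Int)
  show "?E \<subseteq> Pow ?\<Omega>"
    by (auto dest!: sets.sets_into_space)
  \<comment> \<open>The inner product is replaced by its own generator of rectangles, so that the
    outer product is generated by boxes with three measurable sides.\<close>
  have sets: "sets (A \<Otimes>\<^sub>M (B \<Otimes>\<^sub>M C)) = sets (sigma (space A \<times> space (B \<Otimes>\<^sub>M C)) ?E)"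
  proof (rule sets_pair_eq[where Ca="{space A}" and Cb="{space B \<times> space C}"])
    show "?R \<subseteq> Pow (space (B \<Otimes>\<^sub>M C))"
      by (auto simp: space_pair_measure dest!: sets.sets_into_space)
    show "sets (B \<Otimes>\<^sub>M C) = sigma_sets (space (B \<Otimes>\<^sub>M C)) ?R"
      by (simp add: sets_pair_measure space_pair_measure)
  qed (auto simp: space_pair_measure sets.sigma_sets_eq dest: sets.sets_into_space)
  also have "\<dots> = sigma_sets ?\<Omega> ?E"
    by (subst sets_measure_of) (use \<open>?E \<subseteq> Pow ?\<Omega>\<close> in \<open>auto simp: space_pair_measure\<close>)
  finally have *: "sets (A \<Otimes>\<^sub>M (B \<Otimes>\<^sub>M C)) = sigma_sets ?\<Omega> ?E" .
  show "sets P = sigma_sets ?\<Omega> ?E" "sets Q = sigma_sets ?\<Omega> ?E"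
    using P Q * by auto
  show "\<And>X. X \<in> ?E \<Longrightarrow> emeasure P X = emeasure Q X"
    using eq by auto
  show "range (\<lambda>_::nat. ?\<Omega>) \<subseteq> ?E" by blast
  show "(\<Union>i::nat. ?\<Omega>) = ?\<Omega>" by simp
  show "emeasure P ?\<Omega> \<noteq> \<infinity>" for i :: nat
    using finite_measure.emeasure_finite[OF assms(1)] by simp
qed

lemma sets_vimage_algebra_subset:
  assumes "g \<in> measurable M N"
  shows "sets (vimage_algebra (space M) g N) \<subseteq> sets M"
  using assms by (auto simp: sets_vimage_algebra2 measurable_space[OF assms] measurable_sets Pi_def)

text \<open>\<open>G\<close> is left open because it is instantiated twice: with the algebra of
  \<open>Z\<close> alone, where \<open>reduces\<close> is reflexive, and with the algebra of all
  covariates \<open>Z\<close>, where \<open>reduces\<close> is the exogeneity assumption.\<close>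

locale comparison = prob_space M for M :: "'a measure" +
  fixes G :: "'a measure" and N :: "'z measure" and W e :: "'a \<Rightarrow> real" and Z :: "'a \<Rightarrow> 'z"
    and f :: "real \<Rightarrow> 'z \<Rightarrow> real"
  assumes subalg_G: "subalgebra M G"
    and Z_G: "Z \<in> measurable G N"
    and e_meas [measurable]: "e \<in> borel_measurable M"
    and density: "cond_density M W Z N f"
    and indep: "indep_set (sets (vimage_algebra (space M) e borel))
      (sets (vimage_algebra (space M) (\<lambda>\<omega>. (Z \<omega>, W \<omega>)) (N \<Otimes>\<^sub>M borel)))"
    and reduces: "cond_law_reduces M G (vimage_algebra (space M) Z N) (\<lambda>\<omega>. (W \<omega>, e \<omega>)) borel"
begin

abbreviation "H \<equiv> vimage_algebra (space M) Z N"

lemma W_meas [measurable]: "W \<in> borel_measurable M"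
  and Z_meas [measurable]: "Z \<in> measurable M N"
  and f_meas [measurable]: "(\<lambda>(x, z). f x z) \<in> borel_measurable (borel \<Otimes>\<^sub>M N)"
  and f_nonneg: "0 \<le> f x z"
  using density by (auto simp: cond_density_def)

lemma subalg_H: "subalgebra M H"
  by (simp add: subalgebra_def sets_vimage_algebra_subset)

sublocale G: finite_measure_subalgebra M G
  by unfold_locales (rule subalg_G)

sublocale H: finite_measure_subalgebra M H
  by unfold_locales (rule subalg_H)

lemma indep_rect:
  assumes [measurable]: "A \<in> sets borel" "A' \<in> sets borel" "D \<in> sets N"
  shows "prob {\<omega>\<in>space M. e \<omega> \<in> A \<and> W \<omega> \<in> A' \<and> Z \<omega> \<in> D} =
    prob {\<omega>\<in>space M. e \<omega> \<in> A} * prob {\<omega>\<in>space M. W \<omega> \<in> A' \<and> Z \<omega> \<in> D}"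
proof -
  let ?a = "e -` A \<inter> space M" and ?b = "(\<lambda>\<omega>. (Z \<omega>, W \<omega>)) -` (D \<times> A') \<inter> space M"
  have "?a \<in> sets (vimage_algebra (space M) e borel)"
    by (rule in_vimage_algebra) simp
  moreover have "?b \<in> sets (vimage_algebra (space M) (\<lambda>\<omega>. (Z \<omega>, W \<omega>)) (N \<Otimes>\<^sub>M borel))"
    by (rule in_vimage_algebra) simp
  ultimately have "prob (?a \<inter> ?b) = prob ?a * prob ?b"
    by (rule indep_setD[OF indep])
  moreover have "?a \<inter> ?b = {\<omega>\<in>space M. e \<omega> \<in> A \<and> W \<omega> \<in> A' \<and> Z \<omega> \<in> D}"
    "?a = {\<omega>\<in>space M. e \<omega> \<in> A}" "?b = {\<omega>\<in>space M. W \<omega> \<in> A' \<and> Z \<omega> \<in> D}" by auto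
  ultimately show ?thesis by simp
qed

text \<open>Events of \<open>H\<close> are preimages under \<open>Z\<close>, so independence of
  \<open>e\<close> from \<open>(Z, W)\<close> pulls the probability for \<open>e\<close> out of
  every integral over them. Then \<open>reduces\<close> lifts the formula from \<open>H\<close> to
  \<open>G\<close>, and the conditional density evaluates what remains.\<close>

lemma cond_exp_rect:
  assumes [measurable]: "A \<in> sets borel" "A' \<in> sets borel"
  shows "AE \<omega> in M. real_cond_exp M G (\<lambda>\<omega>. indicat_real (A' \<times> A) (W \<omega>, e \<omega>)) \<omega> =
    prob {\<omega>\<in>space M. e \<omega> \<in> A} * (LINT x:A'|lborel. f x (Z \<omega>))"
proof -
  let ?U = "\<lambda>\<omega>. indicat_real (A' \<times> A) (W \<omega>, e \<omega>)"
  let ?p = "prob {\<omega>\<in>space M. e \<omega> \<in> A}"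
  have intW: "integrable M (\<lambda>\<omega>. indicat_real A' (W \<omega>))"
    by (rule integrable_const_bound[of _ 1]) auto
  have intU: "integrable M ?U"
    by (rule integrable_const_bound[of _ 1]) (auto simp: indicator_times split: split_indicator)
  have "AE \<omega> in M. real_cond_exp M H ?U \<omega> = ?p * real_cond_exp M H (\<lambda>\<omega>. indicat_real A' (W \<omega>)) \<omega>"
  proof (rule H.real_cond_exp_charact)
    fix E assume "E \<in> sets H"
    then obtain D where D [measurable]: "D \<in> sets N" and E: "E = Z -` D \<inter> space M"
      by (auto simp: sets_vimage_algebra2 measurable_space[OF Z_meas] Pi_def)
    have "(LINT \<omega>:E|M. ?U \<omega>) = (\<integral>\<omega>. indicator {\<omega>\<in>space M. e \<omega> \<in> A \<and> W \<omega> \<in> A' \<and> Z \<omega> \<in> D} \<omega> \<partial>M)"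
      unfolding set_lebesgue_integral_def
      by (rule Bochner_Integration.integral_cong) (auto simp: E split: split_indicator)
    also have "\<dots> = ?p * prob {\<omega>\<in>space M. W \<omega> \<in> A' \<and> Z \<omega> \<in> D}"
      using indep_rect[of A A' D] by (simp add: Int_def conj_commute conj_left_commute)
    also have "prob {\<omega>\<in>space M. W \<omega> \<in> A' \<and> Z \<omega> \<in> D} = (\<integral>\<omega>. indicator {\<omega>\<in>space M. W \<omega> \<in> A' \<and> Z \<omega> \<in> D} \<omega> \<partial>M)"
      by (simp add: Int_def conj_commute conj_left_commute)
    also have "\<dots> = (LINT \<omega>:E|M. indicat_real A' (W \<omega>))"
      unfolding set_lebesgue_integral_def
      by (rule Bochner_Integration.integral_cong) (auto simp: E split: split_indicator)
    also have "\<dots> = (LINT \<omega>:E|M. real_cond_exp M H (\<lambda>\<omega>. indicat_real A' (W \<omega>)) \<omega>)"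
      by (rule H.real_cond_exp_intA) (use intW \<open>E \<in> sets H\<close> in auto)
    finally show "(LINT \<omega>:E|M. ?U \<omega>) =
        (LINT \<omega>:E|M. ?p * real_cond_exp M H (\<lambda>\<omega>. indicat_real A' (W \<omega>)) \<omega>)"
      by (simp add: set_lebesgue_integral_def mult.left_commute[of _ ?p])
  qed (use intU intW H.real_cond_exp_int(1)[OF intW] in auto)
  moreover have "AE \<omega> in M. real_cond_exp M G ?U \<omega> = real_cond_exp M H ?U \<omega>"
    using reduces unfolding cond_law_reduces_def by (auto simp: borel_prod[symmetric])
  moreover have "AE \<omega> in M. real_cond_exp M H (\<lambda>\<omega>. indicat_real A' (W \<omega>)) \<omega> = (LINT x:A'|lborel. f x (Z \<omega>))"
    using density by (auto simp: cond_density_def)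
  ultimately show ?thesis by eventually_elim simp
qed

lemma nn_integral_density_UNIV: "AE \<omega> in M. (\<integral>\<^sup>+x. f x (Z \<omega>) \<partial>lborel) = 1"
  and nn_integral_density_set: "A \<in> sets borel \<Longrightarrow>
    AE \<omega> in M. (\<integral>\<^sup>+x. f x (Z \<omega>) * indicator A x \<partial>lborel) = ennreal (LINT x:A|lborel. f x (Z \<omega>))"
proof -
  have 1: "AE \<omega> in M. real_cond_exp M H (\<lambda>\<omega>. 1) \<omega> = (LINT x|lborel. f x (Z \<omega>))"
    using density unfolding cond_density_def set_lebesgue_integral_def
    by (elim conjE ballE[of _ _ UNIV]) auto
  have 2: "AE \<omega> in M. real_cond_exp M H (\<lambda>\<omega>. 1) \<omega> = 1"
    by (rule H.real_cond_exp_F_meas) auto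
  \<comment> \<open>A Bochner integral of a non-integrable function is \<open>0\<close> by
    convention, so the value \<open>1\<close> forces integrability.\<close>
  have int: "AE \<omega> in M. integrable lborel (\<lambda>x. f x (Z \<omega>)) \<and> (LINT x|lborel. f x (Z \<omega>)) = 1"
    using 1 2 by eventually_elim (metis not_integrable_integral_eq zero_neq_one)
  then show "AE \<omega> in M. (\<integral>\<^sup>+x. f x (Z \<omega>) \<partial>lborel) = 1"
    by eventually_elim (simp add: nn_integral_eq_integral f_nonneg)
  assume [measurable]: "A \<in> sets borel"
  show "AE \<omega> in M. (\<integral>\<^sup>+x. f x (Z \<omega>) * indicator A x \<partial>lborel) = ennreal (LINT x:A|lborel. f x (Z \<omega>))"
    using int
  proof eventually_elim
    case (elim \<omega>)
    have "integrable lborel (\<lambda>x. indicator A x *\<^sub>R f x (Z \<omega>))"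
      using elim by (intro integrable_mult_indicator) auto
    from nn_integral_eq_integral[OF this] show ?case
      by (simp add: f_nonneg set_lebesgue_integral_def ennreal_indicator[symmetric] ennreal_mult''[symmetric] mult.commute
          del: ennreal_indicator)
  qed
qed

text \<open>The joint law of \<open>(e, Z, W)\<close> on an event \<open>C\<close> of \<open>G\<close> is \<open>P\<^sub>e \<otimes> f(x | z) dx P\<^sub>Z(C \<inter> dz)\<close>, which is checked on
  measurable boxes.\<close>

lemma nn_integral_joint:
  fixes h :: "_ \<Rightarrow> ennreal"
  assumes C: "C \<in> sets G" and h [measurable]: "h \<in> borel_measurable (borel \<Otimes>\<^sub>M (N \<Otimes>\<^sub>M borel))"
  shows "(\<integral>\<^sup>+\<omega>. indicator C \<omega> * h (e \<omega>, Z \<omega>, W \<omega>) \<partial>M) =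
    (\<integral>\<^sup>+a. \<integral>\<^sup>+\<omega>. indicator C \<omega> * (\<integral>\<^sup>+x. ennreal (f x (Z \<omega>)) * h (a, Z \<omega>, x) \<partial>lborel) \<partial>M \<partial>distr M borel e)"
proof -
  have [measurable]: "C \<in> sets M"
    using C subalg_G by (auto simp: subalgebra_def)
  let ?MC = "density M (indicator C)"
  \<comment> \<open>The law of \<open>Z\<close> on \<open>C\<close>. It is finite, so its product
    with \<open>lborel\<close> is sigma-finite and Tonelli applies.\<close>
  define \<nu> where "\<nu> = distr ?MC N Z"
  define Q where "Q = density (distr M borel e \<Otimes>\<^sub>M (\<nu> \<Otimes>\<^sub>M lborel)) (\<lambda>(a, z, x). ennreal (f x z))"
  define P where "P = distr ?MC (borel \<Otimes>\<^sub>M (N \<Otimes>\<^sub>M borel)) (\<lambda>\<omega>. (e \<omega>, Z \<omega>, W \<omega>))"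
  have [measurable_cong]: "sets \<nu> = sets N"
    by (simp add: \<nu>_def)
  have "finite_measure ?MC"
    by (rule finite_measureI) (simp add: emeasure_density)
  then interpret MC: finite_measure ?MC .
  interpret \<nu>: finite_measure \<nu>
    unfolding \<nu>_def by (rule MC.finite_measure_distr) simp
  interpret \<nu>l: pair_sigma_finite \<nu> lborel ..
  interpret \<nu>l: sigma_finite_measure "\<nu> \<Otimes>\<^sub>M lborel" ..
  have Qint: "(\<integral>\<^sup>+y. g y \<partial>Q) =
      (\<integral>\<^sup>+a. \<integral>\<^sup>+\<omega>. indicator C \<omega> * (\<integral>\<^sup>+x. ennreal (f x (Z \<omega>)) * g (a, Z \<omega>, x) \<partial>lborel) \<partial>M \<partial>distr M borel e)"
    if [measurable]: "g \<in> borel_measurable (borel \<Otimes>\<^sub>M (N \<Otimes>\<^sub>M borel))" for g :: "_ \<Rightarrow> ennreal"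
  proof -
    have "(\<integral>\<^sup>+y. g y \<partial>Q) = (\<integral>\<^sup>+y. (case y of (a, z, x) \<Rightarrow> ennreal (f x z)) * g y \<partial>(distr M borel e \<Otimes>\<^sub>M (\<nu> \<Otimes>\<^sub>M lborel)))"
      unfolding Q_def by (rule nn_integral_density) auto
    also have "\<dots> = (\<integral>\<^sup>+a. \<integral>\<^sup>+y. (case y of (z, x) \<Rightarrow> ennreal (f x z) * g (a, z, x)) \<partial>(\<nu> \<Otimes>\<^sub>M lborel) \<partial>distr M borel e)"
      by (subst \<nu>l.nn_integral_fst[symmetric]) (auto simp: split_beta')
    also have "\<dots> = (\<integral>\<^sup>+a. \<integral>\<^sup>+z. \<integral>\<^sup>+x. ennreal (f x z) * g (a, z, x) \<partial>lborel \<partial>\<nu> \<partial>distr M borel e)"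
      by (intro nn_integral_cong, subst lborel.nn_integral_fst[symmetric]) auto
    also have "\<dots> = (\<integral>\<^sup>+a. \<integral>\<^sup>+\<omega>. indicator C \<omega> * (\<integral>\<^sup>+x. ennreal (f x (Z \<omega>)) * g (a, Z \<omega>, x) \<partial>lborel) \<partial>M \<partial>distr M borel e)"
      unfolding \<nu>_def
      by (intro nn_integral_cong, subst nn_integral_distr, simp, simp, subst nn_integral_density) auto
    finally show ?thesis .
  qed
  have "P = Q"
  proof (rule finite_measure_eqI_triple)
    show "finite_measure P"
      unfolding P_def by (rule MC.finite_measure_distr) simp
    show "sets P = sets (borel \<Otimes>\<^sub>M (N \<Otimes>\<^sub>M borel))" "sets Q = sets (borel \<Otimes>\<^sub>M (N \<Otimes>\<^sub>M borel))"
      unfolding P_def Q_def sets_density sets_distr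
      by (auto simp: \<nu>_def intro!: sets_pair_measure_cong)
    fix A :: "real set" and D and A' :: "real set"
    assume [measurable]: "A \<in> sets borel" "D \<in> sets N" "A' \<in> sets borel"
    let ?U = "\<lambda>\<omega>. indicat_real (A' \<times> A) (W \<omega>, e \<omega>)"
    let ?p = "prob {\<omega>\<in>space M. e \<omega> \<in> A}"
    \<comment> \<open>The condition on \<open>Z\<close> is absorbed into the event. As
      \<open>Z\<close> is measurable for \<open>G\<close>, the event \<open>E\<close> stays in
      \<open>G\<close>, and over it the indicator \<open>?U\<close> may be replaced by its
      conditional expectation.\<close>
    define E where "E = C \<inter> (Z -` D \<inter> space M)"
    have "E \<in> sets G"
      using measurable_sets[OF Z_G \<open>D \<in> sets N\<close>] C subalg_G by (auto simp: E_def subalgebra_def)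
    then have [measurable]: "E \<in> sets M"
      using subalg_G by (auto simp: subalgebra_def)
    have intU: "integrable M ?U"
      by (rule integrable_const_bound[of _ 1]) (auto simp: indicator_times split: split_indicator)
    have "emeasure P (A \<times> D \<times> A') = (\<integral>\<^sup>+y. indicator (A \<times> D \<times> A') y \<partial>P)"
      by (rule nn_integral_indicator[symmetric]) (simp add: P_def)
    also have "\<dots> = (\<integral>\<^sup>+\<omega>. indicator (A \<times> D \<times> A') (e \<omega>, Z \<omega>, W \<omega>) \<partial>?MC)"
      unfolding P_def by (rule nn_integral_distr) auto
    also have "\<dots> = (\<integral>\<^sup>+\<omega>. indicator C \<omega> * indicator (A \<times> D \<times> A') (e \<omega>, Z \<omega>, W \<omega>) \<partial>M)"
      by (rule nn_integral_density) auto
    also have "\<dots> = (\<integral>\<^sup>+\<omega>. ennreal (indicator E \<omega> * ?U \<omega>) \<partial>M)"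
      by (rule nn_integral_cong) (auto simp: E_def split: split_indicator)
    also have "\<dots> = ennreal (LINT \<omega>:E|M. ?U \<omega>)"
      unfolding set_lebesgue_integral_def real_scaleR_def
      by (rule nn_integral_eq_integral) (use integrable_mult_indicator[OF \<open>E \<in> sets M\<close> intU] in auto)
    also have "(LINT \<omega>:E|M. ?U \<omega>) = (LINT \<omega>:E|M. real_cond_exp M G ?U \<omega>)"
      by (rule G.real_cond_exp_intA[OF intU \<open>E \<in> sets G\<close>])
    also have "ennreal \<dots> = (\<integral>\<^sup>+\<omega>. ennreal (indicator E \<omega> * real_cond_exp M G ?U \<omega>) \<partial>M)"
      unfolding set_lebesgue_integral_def real_scaleR_def
    proof (rule nn_integral_eq_integral[symmetric])
      show "integrable M (\<lambda>\<omega>. indicat_real E \<omega> * real_cond_exp M G ?U \<omega>)"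
        using integrable_mult_indicator[OF \<open>E \<in> sets M\<close> G.real_cond_exp_int(1)[OF intU]] by simp
      show "AE \<omega> in M. 0 \<le> indicat_real E \<omega> * real_cond_exp M G ?U \<omega>"
        using G.real_cond_exp_pos[of ?U] by auto
    qed
    also have "\<dots> = (\<integral>\<^sup>+\<omega>. ?p * (indicator C \<omega> * (\<integral>\<^sup>+x. ennreal (f x (Z \<omega>)) * indicator (D \<times> A') (Z \<omega>, x) \<partial>lborel)) \<partial>M)"
    proof (rule nn_integral_cong_AE)
      show "AE \<omega> in M. ennreal (indicator E \<omega> * real_cond_exp M G ?U \<omega>) =
          ?p * (indicator C \<omega> * (\<integral>\<^sup>+x. ennreal (f x (Z \<omega>)) * indicator (D \<times> A') (Z \<omega>, x) \<partial>lborel))"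
        using cond_exp_rect[OF \<open>A \<in> sets borel\<close> \<open>A' \<in> sets borel\<close>] nn_integral_density_set[OF \<open>A' \<in> sets borel\<close>] AE_space
      proof eventually_elim
        case (elim \<omega>)
        have "0 \<le> (LINT x:A'|lborel. f x (Z \<omega>))"
          unfolding set_lebesgue_integral_def by (rule Bochner_Integration.integral_nonneg) (simp add: f_nonneg)
        moreover have "(\<integral>\<^sup>+x. ennreal (f x (Z \<omega>)) * indicator A' x \<partial>lborel) = ennreal (LINT x:A'|lborel. f x (Z \<omega>))"
          unfolding elim(2)[symmetric] by (rule nn_integral_cong) (auto split: split_indicator)
        ultimately show ?case
          using elim by (auto simp: E_def indicator_times ennreal_mult split: split_indicator)
      qed
    qed
    also have "\<dots> = (\<integral>\<^sup>+a. indicator A a * (\<integral>\<^sup>+\<omega>. indicator C \<omega> * (\<integral>\<^sup>+x. ennreal (f x (Z \<omega>)) * indicator (D \<times> A') (Z \<omega>, x) \<partial>lborel) \<partial>M) \<partial>distr M borel e)"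
      by (simp add: nn_integral_cmult nn_integral_multc emeasure_distr emeasure_eq_measure vimage_def Int_def conj_commute)
    also have "\<dots> = (\<integral>\<^sup>+y. indicator (A \<times> D \<times> A') y \<partial>Q)"
      by (subst Qint) (auto intro!: nn_integral_cong split: split_indicator)
    also have "\<dots> = emeasure Q (A \<times> D \<times> A')"
      by (rule nn_integral_indicator) (auto simp: Q_def)
    finally show "emeasure P (A \<times> D \<times> A') = emeasure Q (A \<times> D \<times> A')" .
  qed
  have "(\<integral>\<^sup>+\<omega>. indicator C \<omega> * h (e \<omega>, Z \<omega>, W \<omega>) \<partial>M) = (\<integral>\<^sup>+y. h y \<partial>P)"
    unfolding P_def by (subst nn_integral_distr, simp, simp, subst nn_integral_density) auto
  with Qint[OF h] \<open>P = Q\<close> show ?thesis by simp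
qed

section \<open>Marginal and conditional forms of the joint law\<close>

text \<open>For an integrand free of \<open>W\<close> the density integrates out to
  \<open>1\<close>. What is left is independence of \<open>e\<close> from the pair formed by
  \<open>C\<close> and \<open>Z\<close>.\<close>

lemma nn_integral_eZ:
  fixes h :: "_ \<Rightarrow> ennreal"
  assumes C: "C \<in> sets G" and h [measurable]: "h \<in> borel_measurable (borel \<Otimes>\<^sub>M N)"
  shows "(\<integral>\<^sup>+\<omega>. indicator C \<omega> * h (e \<omega>, Z \<omega>) \<partial>M) =
    (\<integral>\<^sup>+a. \<integral>\<^sup>+\<omega>. indicator C \<omega> * h (a, Z \<omega>) \<partial>M \<partial>distr M borel e)"
proof -
  have "(\<integral>\<^sup>+\<omega>. indicator C \<omega> * h (e \<omega>, Z \<omega>) \<partial>M) =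
    (\<integral>\<^sup>+a. \<integral>\<^sup>+\<omega>. indicator C \<omega> * (\<integral>\<^sup>+x. ennreal (f x (Z \<omega>)) * h (a, Z \<omega>) \<partial>lborel) \<partial>M \<partial>distr M borel e)"
    using nn_integral_joint[OF C, of "\<lambda>(a, z, x). h (a, z)"] by simp
  also have "\<dots> = (\<integral>\<^sup>+a. \<integral>\<^sup>+\<omega>. indicator C \<omega> * h (a, Z \<omega>) \<partial>M \<partial>distr M borel e)"
  proof (rule nn_integral_cong, rule nn_integral_cong_AE)
    fix a
    show "AE \<omega> in M. indicator C \<omega> * (\<integral>\<^sup>+x. ennreal (f x (Z \<omega>)) * h (a, Z \<omega>) \<partial>lborel) = indicator C \<omega> * h (a, Z \<omega>)"
      using nn_integral_density_UNIV AE_space by eventually_elim (simp add: nn_integral_multc)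
  qed
  finally show ?thesis .
qed

text \<open>The inner integral is a function of \<open>(e, Z)\<close> only, so
  \<open>nn_integral_eZ\<close> read backwards returns from the product law to the actual noise.
  Thus \<open>W\<close> keeps the density \<open>f\<close> given \<open>e\<close>, \<open>Z\<close>
  and \<open>C\<close>.\<close>

lemma nn_integral_density_W:
  fixes h :: "_ \<Rightarrow> ennreal"
  assumes C: "C \<in> sets G" and h [measurable]: "h \<in> borel_measurable (borel \<Otimes>\<^sub>M (N \<Otimes>\<^sub>M borel))"
  shows "(\<integral>\<^sup>+\<omega>. indicator C \<omega> * h (e \<omega>, Z \<omega>, W \<omega>) \<partial>M) =
    (\<integral>\<^sup>+\<omega>. indicator C \<omega> * (\<integral>\<^sup>+x. ennreal (f x (Z \<omega>)) * h (e \<omega>, Z \<omega>, x) \<partial>lborel) \<partial>M)"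
proof -
  have "(\<lambda>(a, z). \<integral>\<^sup>+x. ennreal (f x z) * h (a, z, x) \<partial>lborel) \<in> borel_measurable (borel \<Otimes>\<^sub>M N)"
    by measurable
  from nn_integral_eZ[OF C this] nn_integral_joint[OF C h] show ?thesis by simp
qed

text \<open>Independence of the noise from every event of \<open>G\<close>, later used to show that
  \<open>e\<close> has mean zero on each of them.\<close>

lemma nn_integral_e:
  fixes g :: "_ \<Rightarrow> ennreal"
  assumes C: "C \<in> sets G" and g [measurable]: "g \<in> borel_measurable borel"
  shows "(\<integral>\<^sup>+\<omega>. indicator C \<omega> * g (e \<omega>) \<partial>M) = emeasure M C * (\<integral>\<^sup>+\<omega>. g (e \<omega>) \<partial>M)"
proof -
  have [measurable]: "C \<in> sets M"
    using C subalg_G by (auto simp: subalgebra_def)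
  show ?thesis
    using nn_integral_eZ[OF C, of "\<lambda>(a, z). g a"] by (simp add: nn_integral_multc nn_integral_cmult nn_integral_distr)
qed

end

section \<open>The inverse-density transform\<close>

text \<open>One comparison with the coefficient of \<open>W\<close> normalised to \<open>1\<close>:
  \<open>m\<close> is the systematic part and the item wins when \<open>W\<close> exceeds
  \<open>e - m(Z)\<close>. Since \<open>support_on\<close> is the set of nonzeros without closure,
  dividing by \<open>f\<close> is safe on the whole open interval.\<close>

locale threshold_comparison = comparison M G N W e Z f
  for M G :: "'a measure" and N :: "'z measure" and W e :: "'a \<Rightarrow> real" and Z :: "'a \<Rightarrow> 'z"
    and f :: "real \<Rightarrow> 'z \<Rightarrow> real" +
  fixes m :: "'z \<Rightarrow> real" and B :: real
  assumes m_meas [measurable]: "m \<in> borel_measurable N"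
    and support: "AE \<omega> in M. support_on UNIV (\<lambda>x. f x (Z \<omega>)) = {-B<..<B}"
    and bounded: "AE \<omega> in M. \<bar>m (Z \<omega>) - e \<omega>\<bar> < B"
    and mean_e: "has_bochner_integral M e 0"
begin

definition Y :: "'a \<Rightarrow> real" where
  "Y \<omega> = (of_bool (e \<omega> - m (Z \<omega>) < W \<omega>) - of_bool (0 < W \<omega>)) / f (W \<omega>) (Z \<omega>)"

text \<open>Minus the threshold for \<open>W\<close>; it plays the role of the conditional mean of
  \<open>Y\<close> given \<open>e\<close> and \<open>Z\<close>.\<close>

definition d :: "'a \<Rightarrow> real" where
  "d \<omega> = m (Z \<omega>) - e \<omega>"

lemma Y_meas [measurable]: "Y \<in> borel_measurable M"
  unfolding Y_def by measurable

lemma d_meas [measurable]: "d \<in> borel_measurable M"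
  unfolding d_def by measurable

lemma sets_G: "C \<in> sets G \<Longrightarrow> C \<in> sets M"
  using subalg_G by (auto simp: subalgebra_def)

text \<open>The difference of the two indicators is, up to sign, the indicator of the interval
  between \<open>0\<close> and \<open>s\<close>, which has length \<open>\<bar>s\<bar>\<close>. The
  sign \<open>c\<close> that disagrees gives \<open>0\<close> on both sides by truncation.\<close>

lemma nn_integral_threshold:
  fixes c s :: real
  assumes "c = 1 \<or> c = -1"
  shows "(\<integral>\<^sup>+x. ennreal (c * (of_bool (s < x) - of_bool (0 < x))) \<partial>lborel) = ennreal (c * - s)"
proof -
  have "(\<integral>\<^sup>+x. ennreal (of_bool (s < x) - of_bool (0 < x)) \<partial>lborel) = (\<integral>\<^sup>+x. indicator {s<..0} x \<partial>lborel)"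
    by (rule nn_integral_cong) (auto simp: ennreal_neg split: split_indicator)
  moreover have "(\<integral>\<^sup>+x. ennreal (- (of_bool (s < x) - of_bool (0 < x))) \<partial>lborel) = (\<integral>\<^sup>+x. indicator {0<..s} x \<partial>lborel)"
    by (rule nn_integral_cong) (auto simp: ennreal_neg split: split_indicator)
  ultimately show ?thesis
    using assms by (cases "s \<le> 0") (auto simp: ennreal_neg)
qed

text \<open>The sign \<open>c\<close> selects the positive or the negative part, since \<open>ennreal\<close> truncates at \<open>0\<close>.\<close>

lemma nn_integral_signed:
  assumes C: "C \<in> sets G" and c: "c = 1 \<or> c = -1"
  shows "(\<integral>\<^sup>+\<omega>. indicator C \<omega> * ennreal (c * Y \<omega>) \<partial>M) = (\<integral>\<^sup>+\<omega>. indicator C \<omega> * ennreal (c * d \<omega>) \<partial>M)"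
proof -
  define h where "h = (\<lambda>(a, z, x). ennreal (c * ((of_bool (a - m z < x) - of_bool (0 < x)) / f x z)))"
  have [measurable]: "h \<in> borel_measurable (borel \<Otimes>\<^sub>M (N \<Otimes>\<^sub>M borel))"
    unfolding h_def by measurable
  have "(\<integral>\<^sup>+\<omega>. indicator C \<omega> * ennreal (c * Y \<omega>) \<partial>M) = (\<integral>\<^sup>+\<omega>. indicator C \<omega> * h (e \<omega>, Z \<omega>, W \<omega>) \<partial>M)"
    by (simp add: h_def Y_def)
  also have "\<dots> = (\<integral>\<^sup>+\<omega>. indicator C \<omega> * (\<integral>\<^sup>+x. ennreal (f x (Z \<omega>)) * h (e \<omega>, Z \<omega>, x) \<partial>lborel) \<partial>M)"
    by (rule nn_integral_density_W[OF C]) simp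
  also have "\<dots> = (\<integral>\<^sup>+\<omega>. indicator C \<omega> * ennreal (c * d \<omega>) \<partial>M)"
  proof (rule nn_integral_cong_AE)
    show "AE \<omega> in M. indicator C \<omega> * (\<integral>\<^sup>+x. ennreal (f x (Z \<omega>)) * h (e \<omega>, Z \<omega>, x) \<partial>lborel) =
        indicator C \<omega> * ennreal (c * d \<omega>)"
      using support bounded
    proof eventually_elim
      case (elim \<omega>)
      \<comment> \<open>Inside the support the density cancels. Outside it both indicators agree,
        because the threshold lies strictly between \<open>-B\<close> and \<open>B\<close>, so the
        numerator vanishes and division by zero does no harm.\<close>
      have "ennreal (f x (Z \<omega>)) * h (e \<omega>, Z \<omega>, x) =
          ennreal (c * (of_bool (e \<omega> - m (Z \<omega>) < x) - of_bool (0 < x)))" for x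
      proof (cases "x \<in> {-B<..<B}")
        case True
        then have "x \<in> support_on UNIV (\<lambda>x. f x (Z \<omega>))"
          unfolding elim(1) .
        then have "f x (Z \<omega>) \<noteq> 0"
          by (simp add: support_on_def)
        then show ?thesis
          by (simp add: h_def ennreal_mult'[symmetric] f_nonneg)
      next
        case False
        then have "(e \<omega> - m (Z \<omega>) < x) = (0 < x)"
          using elim(2) by auto
        then show ?thesis
          by (simp add: h_def)
      qed
      then show ?case
        using nn_integral_threshold[OF c, of "e \<omega> - m (Z \<omega>)"] by (simp add: d_def)
    qed
  qed
  finally show ?thesis .
qed

section \<open>Integrability and conditional mean of the transformed outcome\<close>

lemma nn_integral_abs:
  assumes C: "C \<in> sets G"
  shows "(\<integral>\<^sup>+\<omega>. indicator C \<omega> * ennreal \<bar>Y \<omega>\<bar> \<partial>M) = (\<integral>\<^sup>+\<omega>. indicator C \<omega> * ennreal \<bar>d \<omega>\<bar> \<partial>M)"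
proof -
  note [measurable] = sets_G[OF C]
  have *: "ennreal \<bar>y\<bar> = ennreal (1 * y) + ennreal (- 1 * y)" for y :: real
    by (cases "0 \<le> y") (auto simp: ennreal_neg)
  show ?thesis
    unfolding * distrib_left
    by (simp only: nn_integral_add nn_integral_signed[OF C] simp_thms borel_measurable_times_ennreal borel_measurable_indicator
        sets_G[OF C] measurable_compose[OF _ measurable_ennreal] borel_measurable_times borel_measurable_const Y_meas d_meas)
qed

lemma integrable_d: "integrable M d"
  by (rule integrable_const_bound[of _ B]) (use bounded in \<open>auto simp: d_def elim!: eventually_mono\<close>)

text \<open>The factor \<open>1 / f\<close> may be unbounded, so no pointwise bound is available.
  Instead the absolute moment equals that of \<open>d\<close>, which is bounded by
  \<open>B\<close>.\<close>

lemma integrable_Y: "integrable M Y"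
proof (rule integrableI_bounded)
  have "space M \<in> sets G"
    using subalg_G by (metis sets.top subalgebra_def)
  from nn_integral_abs[OF this] have "(\<integral>\<^sup>+\<omega>. ennreal (norm (Y \<omega>)) \<partial>M) = (\<integral>\<^sup>+\<omega>. ennreal (norm (d \<omega>)) \<partial>M)"
    by (simp cong: nn_integral_cong_simp)
  then show "(\<integral>\<^sup>+\<omega>. ennreal (norm (Y \<omega>)) \<partial>M) < \<infinity>"
    using integrable_d by (simp add: integrable_iff_bounded)
qed simp

lemma integrable_e: "integrable M e"
  using mean_e by (simp add: has_bochner_integral_iff)

lemma integrable_mZ: "integrable M (\<lambda>\<omega>. m (Z \<omega>))"
  using Bochner_Integration.integrable_add[OF integrable_d integrable_e] by (simp add: d_def)

lemma set_integral_Y: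
  assumes C: "C \<in> sets G"
  shows "(LINT \<omega>:C|M. Y \<omega>) = (LINT \<omega>:C|M. d \<omega>)"
proof -
  have "(LINT \<omega>:C|M. g \<omega>) = enn2real (\<integral>\<^sup>+\<omega>. indicator C \<omega> * ennreal (1 * g \<omega>) \<partial>M)
      - enn2real (\<integral>\<^sup>+\<omega>. indicator C \<omega> * ennreal (- 1 * g \<omega>) \<partial>M)" if "integrable M g" for g
    unfolding set_lebesgue_integral_def
    by (subst real_lebesgue_integral_def[OF integrable_mult_indicator[OF sets_G[OF C] that]])
       (auto intro!: arg_cong2[where f="(-)"] arg_cong[where f=enn2real] nn_integral_cong split: split_indicator)
  from this[OF integrable_Y] this[OF integrable_d] show ?thesis
    by (simp only: nn_integral_signed[OF C] simp_thms)
qed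

text \<open>By \<open>nn_integral_e\<close> both the positive and the negative part of
  \<open>e\<close> pick up the factor \<open>prob C\<close>, so their difference is a multiple of
  the mean.\<close>

lemma set_integral_e:
  assumes C: "C \<in> sets G"
  shows "(LINT \<omega>:C|M. e \<omega>) = 0"
proof -
  have "(LINT \<omega>:C|M. e \<omega>) = enn2real (\<integral>\<^sup>+\<omega>. indicator C \<omega> * ennreal (e \<omega>) \<partial>M)
      - enn2real (\<integral>\<^sup>+\<omega>. indicator C \<omega> * ennreal (- e \<omega>) \<partial>M)"
    unfolding set_lebesgue_integral_def
    by (subst real_lebesgue_integral_def[OF integrable_mult_indicator[OF sets_G[OF C] integrable_e]])
       (auto intro!: arg_cong2[where f="(-)"] arg_cong[where f=enn2real] nn_integral_cong split: split_indicator)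
  also have "\<dots> = prob C * (enn2real (\<integral>\<^sup>+\<omega>. ennreal (e \<omega>) \<partial>M) - enn2real (\<integral>\<^sup>+\<omega>. ennreal (- e \<omega>) \<partial>M))"
    using nn_integral_e[OF C, of ennreal] nn_integral_e[OF C, of "\<lambda>x. ennreal (- x)"]
    by (simp add: enn2real_mult measure_def right_diff_distrib)
  also have "\<dots> = 0"
    using mean_e real_lebesgue_integral_def[OF integrable_e] by (simp add: has_bochner_integral_iff)
  finally show ?thesis .
qed

text \<open>Over an event of \<open>G\<close>, \<open>Y\<close> integrates like \<open>d\<close>,
  that is, like \<open>m(Z) - e\<close>, and the noise contributes nothing. The remaining
  \<open>m(Z)\<close> is measurable for \<open>G\<close>.\<close>

lemma cond_exp_Y: "AE \<omega> in M. real_cond_exp M G Y \<omega> = m (Z \<omega>)"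
proof (rule G.real_cond_exp_charact)
  show "(\<lambda>\<omega>. m (Z \<omega>)) \<in> borel_measurable G"
    using Z_G by measurable
  fix C assume C: "C \<in> sets G"
  have si: "set_integrable M C g" if "integrable M g" for g :: "'a \<Rightarrow> real"
    unfolding set_integrable_def by (rule integrable_mult_indicator[OF sets_G[OF C] that])
  have "(LINT \<omega>:C|M. m (Z \<omega>)) = (LINT \<omega>:C|M. d \<omega> + e \<omega>)"
    by (simp add: d_def)
  also have "\<dots> = (LINT \<omega>:C|M. d \<omega>) + (LINT \<omega>:C|M. e \<omega>)"
    by (rule set_integral_add(2)) (auto intro!: si integrable_d integrable_e)
  finally show "(LINT \<omega>:C|M. Y \<omega>) = (LINT \<omega>:C|M. m (Z \<omega>))"
    by (simp add: set_integral_Y[OF C] set_integral_e[OF C])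
qed (rule integrable_Y integrable_mZ)+

lemma expectation_Y: "(\<integral>\<omega>. Y \<omega> \<partial>M) = (\<integral>\<omega>. m (Z \<omega>) \<partial>M)"
  using G.real_cond_exp_int(2)[OF integrable_Y] integral_cong_AE[OF _ _ cond_exp_Y] by simp

text \<open>The weight is merely integrable and \<open>Y\<close> may be unbounded, so integrability
  of the product is the issue. It follows from the bound \<open>B\<close> on the conditional
  expectation of \<open>\<bar>Y\<bar>\<close>, which gives a mean of at most \<open>B\<close> times
  that of \<open>\<bar>q\<bar>\<close>. After that \<open>q\<close> can be pulled out of the
  conditional expectation.\<close>

lemma
  assumes [measurable]: "q \<in> borel_measurable G" and q: "integrable M q"
  shows integrable_weighted_Y: "integrable M (\<lambda>\<omega>. q \<omega> * Y \<omega>)"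
    and integrable_weighted_mZ: "integrable M (\<lambda>\<omega>. q \<omega> * m (Z \<omega>))"
    and expectation_weighted_Y: "(\<integral>\<omega>. q \<omega> * Y \<omega> \<partial>M) = (\<integral>\<omega>. q \<omega> * m (Z \<omega>) \<partial>M)"
proof -
  have [measurable]: "q \<in> borel_measurable M"
    using q by auto
  have "AE \<omega> in M. nn_cond_exp M G (\<lambda>\<omega>. ennreal \<bar>d \<omega>\<bar>) \<omega> \<le> nn_cond_exp M G (\<lambda>\<omega>. ennreal B) \<omega>"
    by (rule G.nn_cond_exp_mono) (use bounded in \<open>auto simp: d_def elim!: eventually_mono\<close>)
  moreover have "AE \<omega> in M. ennreal B = nn_cond_exp M G (\<lambda>\<omega>. ennreal B) \<omega>"
    by (rule G.nn_cond_exp_F_meas) simp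
  \<comment> \<open>Having equal integrals over all events of \<open>G\<close>,
    \<open>\<bar>d\<bar>\<close> and \<open>\<bar>Y\<bar>\<close> share their conditional
    expectation, so the bound on \<open>d\<close> transfers.\<close>
  moreover have "AE \<omega> in M. nn_cond_exp M G (\<lambda>\<omega>. ennreal \<bar>d \<omega>\<bar>) \<omega> = nn_cond_exp M G (\<lambda>\<omega>. ennreal \<bar>Y \<omega>\<bar>) \<omega>"
  proof (rule G.nn_cond_exp_charact)
    fix C assume C: "C \<in> sets G"
    have "(\<integral>\<^sup>+\<omega>. indicator C \<omega> * ennreal \<bar>d \<omega>\<bar> \<partial>M) = (\<integral>\<^sup>+\<omega>. indicator C \<omega> * nn_cond_exp M G (\<lambda>\<omega>. ennreal \<bar>d \<omega>\<bar>) \<omega> \<partial>M)"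
      by (rule G.nn_cond_exp_intg[symmetric]) (use C in auto)
    then show "(\<integral>\<^sup>+\<omega>\<in>C. ennreal \<bar>Y \<omega>\<bar> \<partial>M) = (\<integral>\<^sup>+\<omega>\<in>C. nn_cond_exp M G (\<lambda>\<omega>. ennreal \<bar>d \<omega>\<bar>) \<omega> \<partial>M)"
      using nn_integral_abs[OF C] by (simp add: mult.commute)
  qed auto
  ultimately have le: "AE \<omega> in M. nn_cond_exp M G (\<lambda>\<omega>. ennreal \<bar>Y \<omega>\<bar>) \<omega> \<le> ennreal B"
    by eventually_elim simp
  show int: "integrable M (\<lambda>\<omega>. q \<omega> * Y \<omega>)"
  proof (rule integrableI_bounded)
    have "(\<integral>\<^sup>+\<omega>. ennreal (norm (q \<omega> * Y \<omega>)) \<partial>M) = (\<integral>\<^sup>+\<omega>. ennreal \<bar>q \<omega>\<bar> * ennreal \<bar>Y \<omega>\<bar> \<partial>M)"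
      by (simp add: abs_mult ennreal_mult)
    also have "\<dots> = (\<integral>\<^sup>+\<omega>. ennreal \<bar>q \<omega>\<bar> * nn_cond_exp M G (\<lambda>\<omega>. ennreal \<bar>Y \<omega>\<bar>) \<omega> \<partial>M)"
      by (rule G.nn_cond_exp_intg[symmetric]) auto
    also have "\<dots> \<le> (\<integral>\<^sup>+\<omega>. ennreal \<bar>q \<omega>\<bar> * ennreal B \<partial>M)"
      by (rule nn_integral_mono_AE) (use le in \<open>auto elim!: eventually_mono intro: mult_left_mono\<close>)
    also have "\<dots> = (\<integral>\<^sup>+\<omega>. ennreal (norm (q \<omega>)) \<partial>M) * ennreal B"
      by (simp add: nn_integral_multc)
    also have "\<dots> < \<infinity>"
      using q by (simp add: integrable_iff_bounded ennreal_mult_less_top)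
    finally show "(\<integral>\<^sup>+\<omega>. ennreal (norm (q \<omega> * Y \<omega>)) \<partial>M) < \<infinity>" .
  qed simp
  have eq: "AE \<omega> in M. q \<omega> * real_cond_exp M G Y \<omega> = q \<omega> * m (Z \<omega>)"
    using cond_exp_Y by eventually_elim simp
  note intg = G.real_cond_exp_intg[OF int \<open>q \<in> borel_measurable G\<close> Y_meas]
  show "integrable M (\<lambda>\<omega>. q \<omega> * m (Z \<omega>))"
    by (rule integrable_cong_AE_imp[OF intg(1)]) (use eq in auto)
  show "(\<integral>\<omega>. q \<omega> * Y \<omega> \<partial>M) = (\<integral>\<omega>. q \<omega> * m (Z \<omega>) \<partial>M)"
    unfolding intg(2)[symmetric] by (rule integral_cong_AE[OF _ _ eq]) auto
qed

end

section \<open>Projection matrices and smallest eigenvalues\<close>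

text \<open>The Sherman-Morrison inverse of a multiple of the identity minus the all-ones matrix,
  whose square is \<open>n\<close> times itself.\<close>

lemma V_mat_right_inverse:
  "(V_mat :: real^('n::{finite,linorder})^('n::{finite,linorder})) ** ((1 / (real CARD('n) + 1)) *\<^sub>R (mat 1 + (\<chi> k l. 1))) = mat 1"
proof -
  have "(\<Sum>k\<in>UNIV. (mat (real CARD('n) + 1) - (\<chi> k l. 1)) $ i $ k * ((1 / (real CARD('n) + 1)) *\<^sub>R (mat 1 + (\<chi> k l. 1))) $ k $ j)
      = (mat 1 :: real^('n::{finite,linorder})^('n::{finite,linorder})) $ i $ j" for i j :: 'n
  proof -
    have "(\<Sum>k\<in>UNIV. (mat (real CARD('n) + 1) - (\<chi> k l. 1)) $ i $ k * ((1 / (real CARD('n) + 1)) *\<^sub>R (mat 1 + (\<chi> k l. 1))) $ k $ j)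
      = (\<Sum>k\<in>UNIV. ((real CARD('n) + 1) * of_bool (i = k) - 1) * ((of_bool (k = j) + 1) / (real CARD('n) + 1)))"
      by (rule sum.cong) (auto simp: mat_def)
    also have "\<dots> = (\<Sum>k\<in>UNIV. of_bool (i = k) * (of_bool (k = j) + 1) - (of_bool (k = j) + 1) / (real CARD('n) + 1))"
      by (rule sum.cong) (auto simp: field_simps)
    also have "\<dots> = of_bool (i = j)"
      by (simp add: sum_subtractf sum.distrib sum_divide_distrib[symmetric] algebra_simps add_divide_distrib[symmetric])
    finally show ?thesis by (simp add: mat_def)
  qed
  then show ?thesis
    by (simp add: V_mat_eq matrix_matrix_mult_def vec_eq_iff)
qed

lemma invertible_V_mat: "invertible (V_mat :: real^('n::{finite,linorder})^('n::{finite,linorder}))"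
  unfolding invertible_right_inverse using V_mat_right_inverse by blast

lemma matrix_inv_left_right:
  fixes A :: "'a::semiring_1^'n^'m"
  assumes "invertible A"
  shows "matrix_inv A ** A = mat 1" "A ** matrix_inv A = mat 1"
  using someI_ex[OF assms[unfolded invertible_def]] by (auto simp: matrix_inv_def)

lemma V_mat_inv_U: "matrix_inv V_mat ** transpose U_mat ** U_mat = (mat 1 :: real^('n::{finite,linorder})^('n::{finite,linorder}))"
  by (simp add: matrix_mul_assoc[symmetric] V_mat_def[symmetric] matrix_inv_left_right invertible_V_mat)

lemma matrix_diff_ldistrib: "A ** (B - C) = A ** B - A ** (C :: real^'k^'m)" for A :: "real^'m::finite^'l"
  by (simp add: matrix_matrix_mult_def vec_eq_iff right_diff_distrib sum_subtractf)

lemma matrix_diff_rdistrib: "(A - B) ** C = A ** C - B ** (C :: real^'k^'m)" for A :: "real^'m::finite^'l"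
  by (simp add: matrix_matrix_mult_def vec_eq_iff left_diff_distrib sum_subtractf)

lemma transpose_diff: "transpose (A - B) = transpose A - transpose (B :: real^'k^'m)"
  by (simp add: transpose_def vec_eq_iff)

text \<open>This removes the merit parameters from the normal equations.\<close>

lemma D_mat_U: "D_mat ** U_mat = (0 :: real^('n::{finite,linorder})^('n::{finite,linorder} pairs))"
  by (simp add: D_mat_def matrix_diff_rdistrib matrix_mul_assoc[symmetric] V_mat_def[symmetric] matrix_inv_left_right invertible_V_mat)

text \<open>Expanding the transposed factor leaves \<open>D_mat\<close> minus a multiple of
  \<open>transpose U_mat ** D_mat\<close>, which is zero. Transposing the resulting identity also
  yields the symmetry of \<open>D_mat\<close>.\<close>

lemma D_mat_idem: "transpose D_mat ** D_mat = (D_mat :: real^('n::{finite,linorder} pairs)^('n::{finite,linorder} pairs))"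
proof -
  let ?U = "U_mat :: real^('n::{finite,linorder})^('n::{finite,linorder} pairs)" and ?I = "matrix_inv V_mat :: real^('n::{finite,linorder})^('n::{finite,linorder})"
  have "transpose ?U ** D_mat = 0"
    by (simp add: D_mat_def matrix_diff_ldistrib matrix_mul_assoc V_mat_def[symmetric] matrix_inv_left_right invertible_V_mat)
  moreover have "transpose D_mat = mat 1 - ?U ** (transpose ?I ** transpose ?U)"
    by (simp add: D_mat_def transpose_diff matrix_transpose_mul transpose_mat)
  ultimately show ?thesis
    by (simp add: matrix_diff_rdistrib matrix_mul_assoc[symmetric])
qed

section \<open>Smallest eigenvalue of a symmetric matrix\<close>

lemma symmetric_matrix_dot:
  fixes A :: "real^'p::finite^'p"
  assumes "transpose A = A"
  shows "(A *v x) \<bullet> y = x \<bullet> (A *v y)"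
  by (metis assms dot_lmul_matrix vector_transpose_matrix)

text \<open>Eigenvectors of distinct eigenvalues are orthogonal, hence independent, hence finitely
  many. Finiteness is what lets \<open>Min\<close> bound the eigenvalues from below.\<close>

lemma finite_eigenvalues:
  assumes sym: "transpose A = A"
  shows "finite (eigenvalues A)"
proof -
  have "\<forall>k\<in>eigenvalues A. \<exists>v. v \<noteq> 0 \<and> A *v v = k *\<^sub>R v"
    by (simp add: eigenvalues_def)
  then obtain v where v: "\<And>k. k \<in> eigenvalues A \<Longrightarrow> v k \<noteq> 0 \<and> A *v v k = k *\<^sub>R v k"
    by metis
  have "inj_on v (eigenvalues A)"
    by (rule inj_onI) (metis v scaleR_right_imp_eq)
  moreover have "pairwise orthogonal (v ` eigenvalues A)"
  proof (clarsimp simp: pairwise_def orthogonal_def)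
    fix k l assume "k \<in> eigenvalues A" "l \<in> eigenvalues A" "v k \<noteq> v l"
    then show "v k \<bullet> v l = 0"
      using symmetric_matrix_dot[OF sym, of "v k" "v l"] v[of k] v[of l] by auto
  qed
  then have "independent (v ` eigenvalues A)"
    by (rule pairwise_orthogonal_independent) (use v in auto)
  then have "finite (v ` eigenvalues A)"
    by (rule finiteI_independent)
  ultimately show ?thesis
    by (metis finite_imageD)
qed

text \<open>The minimum of the quadratic form on the unit sphere is attained at an eigenvector.\<close>

lemma lambda_min_le_quadratic_form:
  fixes A :: "real^'p::finite^'p"
  assumes sym: "transpose A = A"
  shows "lambda_min A * (x \<bullet> x) \<le> x \<bullet> (A *v x)"
proof -
  let ?S = "sphere (0 :: real^'p) 1"
  have "axis undefined 1 \<in> ?S"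
    by (simp add: norm_axis_1)
  then have "?S \<noteq> {}" by blast
  moreover have "continuous_on ?S (\<lambda>y. y \<bullet> (A *v y))"
    by (intro continuous_intros linear_continuous_on) (simp add: matrix_vector_mul_bounded_linear)
  ultimately obtain u where u: "u \<in> ?S" "\<And>y. y \<in> ?S \<Longrightarrow> u \<bullet> (A *v u) \<le> y \<bullet> (A *v y)"
    using continuous_attains_inf[OF compact_sphere, of 0 1 "\<lambda>y. y \<bullet> (A *v y)"] by blast
  define k where "k = u \<bullet> (A *v u)"
  \<comment> \<open>The form shifted by its minimum on the sphere: nonnegative everywhere and zero
    at \<open>u\<close>.\<close>
  define q where "q y = y \<bullet> (A *v y) - k * (y \<bullet> y)" for y
  have q_nonneg: "0 \<le> q y" for y
  proof (cases "y = 0")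
    case False
    have "k \<le> (y /\<^sub>R norm y) \<bullet> (A *v (y /\<^sub>R norm y))"
      unfolding k_def by (rule u(2)) (use False in simp)
    also have "\<dots> = (y \<bullet> (A *v y)) / (y \<bullet> y)"
      by (simp only: matrix_vector_mult_scaleR inner_scaleR_left inner_scaleR_right dot_square_norm power2_eq_square
          divide_inverse inverse_mult_distrib mult_ac)
    finally show ?thesis
      using False by (simp add: q_def pos_le_divide_eq)
  qed (simp add: q_def)
  \<comment> \<open>Half the gradient of \<open>q\<close> at \<open>u\<close>. Were it nonzero, a
    small step against it would make \<open>q\<close> negative.\<close>
  define w where "w = A *v u - k *\<^sub>R u"
  have "w = 0"
  proof (rule ccontr)
    assume "w \<noteq> 0"
    then have w: "0 < w \<bullet> w" by simp
    \<comment> \<open>A step length making the quadratic term \<open>s * s * q w\<close> smaller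
      than \<open>s * (w \<bullet> w)\<close>, half the linear decrease. The \<open>+ 1\<close>
      keeps the denominator positive when \<open>q w\<close> is zero.\<close>
    define s where "s = w \<bullet> w / (q w + 1)"
    have s: "0 < s" "s * q w < w \<bullet> w"
      using w q_nonneg[of w] by (auto simp: s_def field_simps)
    have "u \<bullet> u = 1"
      using u(1) by (simp add: dot_square_norm)
    then have "q u = 0"
      by (simp add: q_def k_def)
    have "u \<bullet> (A *v w) = w \<bullet> (A *v u)"
      using symmetric_matrix_dot[OF sym, of u w] by (simp add: inner_commute)
    then have "q (u - s *\<^sub>R w) = q u + s * (s * q w) - 2 * s * (w \<bullet> (A *v u) - k * (w \<bullet> u))"
      by (simp add: q_def matrix_vector_mult_diff_distrib matrix_vector_mult_scaleR inner_diff_left inner_diff_right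
          inner_commute[of u w]) (simp add: algebra_simps)
    also have "w \<bullet> (A *v u) - k * (w \<bullet> u) = w \<bullet> w"
      by (simp add: w_def inner_diff_right)
    also have "q u + s * (s * q w) - 2 * s * (w \<bullet> w) < s * (w \<bullet> w) - 2 * s * (w \<bullet> w)"
      using s \<open>q u = 0\<close> by simp
    also have "\<dots> < 0"
      using s w by simp
    finally show False
      using q_nonneg[of "u - s *\<^sub>R w"] by simp
  qed
  moreover have "u \<noteq> 0"
    using u(1) by auto
  ultimately have "k \<in> eigenvalues A"
    by (auto simp: eigenvalues_def w_def)
  then have "lambda_min A \<le> k"
    unfolding lambda_min_def by (rule Min_le[OF finite_eigenvalues[OF sym]])
  then have "lambda_min A * (x \<bullet> x) \<le> k * (x \<bullet> x)"
    by (rule mult_right_mono) simp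
  then show ?thesis
    using q_nonneg[of x] by (simp add: q_def)
qed

lemma invertible_positive_definite:
  fixes A :: "real^'p::finite^'p"
  assumes "\<And>x. x \<noteq> 0 \<Longrightarrow> 0 < x \<bullet> (A *v x)"
  shows "invertible A"
  unfolding invertible_left_inverse matrix_left_invertible_ker
  using assms by (metis inner_zero_right less_irrefl)

section \<open>Componentwise integration of vector-valued functions\<close>

lemma integrable_vec:
  fixes g :: "'a \<Rightarrow> 'b::euclidean_space^'n::finite"
  assumes "\<And>i. integrable M (\<lambda>x. g x $ i)"
  shows "integrable M g"
proof -
  have "bounded_linear (axis i :: 'b \<Rightarrow> 'b^'n)" for i
    unfolding linear_conv_bounded_linear[symmetric] by (rule linearI) (auto simp: vec_eq_iff axis_def)
  then have "integrable M (\<lambda>x. \<Sum>i\<in>UNIV. axis i (g x $ i))"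
    using assms by (intro Bochner_Integration.integrable_sum) (rule integrable_bounded_linear)
  moreover have "g x = (\<Sum>i\<in>UNIV. axis i (g x $ i))" for x
    by (simp add: vec_eq_iff axis_def if_distrib cong: if_cong)
  ultimately show ?thesis by simp
qed

lemma integral_vec_nth: "integrable M g \<Longrightarrow> (\<integral>x. g x \<partial>M) $ i = (\<integral>x. g x $ i \<partial>M)"
  for g :: "'a \<Rightarrow> 'b::euclidean_space^'n::finite"
  by (rule integral_bounded_linear[OF bounded_linear_vec_nth, symmetric])

section \<open>Normal equations\<close>

lemma borel_measurable_matrix_mult_component:
  assumes "\<And>l. (\<lambda>\<omega>. Q \<omega> $ l $ k) \<in> borel_measurable G"
  shows "(\<lambda>\<omega>. ((D :: real^'m::finite^'l) ** Q \<omega>) $ e $ k) \<in> borel_measurable G"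
  using assms by (simp add: matrix_matrix_mult_def)

text \<open>The regression argument apart from the model. Hypothesis \<open>weighted\<close> is the
  weak form of the statement that \<open>Yb\<close> has conditional mean
  \<open>c + Zb *v \<eta>\<close> given \<open>G\<close>; it is applied with the entries of
  \<open>D ** Zb\<close> as weights.\<close>

lemma normal_equations:
  fixes D :: "real^'m::finite^'m" and c :: "real^'m" and \<eta> :: "real^'p::finite"
    and Zb :: "'a \<Rightarrow> real^'p^'m" and Yb :: "'a \<Rightarrow> real^'m"
  defines "A \<equiv> \<lambda>\<omega>. transpose (Zb \<omega>) ** D ** Zb \<omega>"
  assumes "prob_space M" and subalg: "subalgebra M G"
    and D: "transpose D ** D = D" and Dc: "D *v c = 0"
    and Zb: "\<And>e k. (\<lambda>\<omega>. Zb \<omega> $ e $ k) \<in> borel_measurable G"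
    and int_A: "integrable M A"
    and weighted: "\<And>q e. q \<in> borel_measurable G \<Longrightarrow> integrable M q \<Longrightarrow>
      integrable M (\<lambda>\<omega>. q \<omega> * Yb \<omega> $ e) \<and> integrable M (\<lambda>\<omega>. q \<omega> * (c + Zb \<omega> *v \<eta>) $ e) \<and>
      (\<integral>\<omega>. q \<omega> * Yb \<omega> $ e \<partial>M) = (\<integral>\<omega>. q \<omega> * (c + Zb \<omega> *v \<eta>) $ e \<partial>M)"
    and lam: "0 < lam" "0 < r" "AE \<omega> in M. lam \<le> lambda_min (r *\<^sub>R A \<omega>)"
  shows "invertible (\<integral>\<omega>. A \<omega> \<partial>M)"
    and "integrable M (\<lambda>\<omega>. (transpose (Zb \<omega>) ** D) *v Yb \<omega>)"
    and "\<eta> = matrix_inv (\<integral>\<omega>. A \<omega> \<partial>M) *v (\<integral>\<omega>. (transpose (Zb \<omega>) ** D) *v Yb \<omega> \<partial>M)"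
proof -
  interpret prob_space M by fact
  have symD: "transpose D = D"
    by (metis D matrix_transpose_mul transpose_transpose)
  define R where "R \<omega> = D ** Zb \<omega>" for \<omega>
  have ZD: "transpose (Zb \<omega>) ** D = transpose (R \<omega>)" for \<omega>
    by (simp add: R_def matrix_transpose_mul symD)
  have A_R: "A \<omega> = transpose (R \<omega>) ** R \<omega>" for \<omega>
    unfolding A_def R_def matrix_transpose_mul by (metis D matrix_mul_assoc)
  have symA: "transpose (r *\<^sub>R A \<omega>) = r *\<^sub>R A \<omega>" for \<omega>
    by (simp add: A_R matrix_transpose_mul transpose_scalar)
  have int_A_nth: "integrable M (\<lambda>\<omega>. A \<omega> $ k $ l)" for k l
    by (intro integrable_bounded_linear[OF bounded_linear_vec_nth] int_A)
  have Av: "bounded_linear (\<lambda>B. B *v v)" for v :: "real^'p"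
    unfolding linear_conv_bounded_linear[symmetric]
    by (rule linearI) (simp_all add: matrix_vector_mult_add_rdistrib scaleR_matrix_vector_assoc)
  have int_Av: "integrable M (\<lambda>\<omega>. A \<omega> *v v)" and integral_Av: "(\<integral>\<omega>. A \<omega> *v v \<partial>M) = (\<integral>\<omega>. A \<omega> \<partial>M) *v v" for v
    by (rule integrable_bounded_linear[OF Av int_A], rule integral_bounded_linear[OF Av int_A])

  show inv: "invertible (\<integral>\<omega>. A \<omega> \<partial>M)"
  proof (rule invertible_positive_definite)
    fix v :: "real^'p" assume "v \<noteq> 0"
    \<comment> \<open>The eigenvalue bound becomes a deterministic lower bound on the quadratic form
      and so survives taking the expectation.\<close>
    have "AE \<omega> in M. lam * (v \<bullet> v) / r \<le> v \<bullet> (A \<omega> *v v)"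
      using lam(3)
    proof eventually_elim
      case (elim \<omega>)
      have "lam * (v \<bullet> v) \<le> lambda_min (r *\<^sub>R A \<omega>) * (v \<bullet> v)"
        using elim by (rule mult_right_mono) simp
      also have "\<dots> \<le> v \<bullet> ((r *\<^sub>R A \<omega>) *v v)"
        by (rule lambda_min_le_quadratic_form[OF symA])
      also have "\<dots> = r * (v \<bullet> (A \<omega> *v v))"
        by (simp add: scaleR_matrix_vector_assoc[symmetric])
      finally show ?case
        using lam(2) by (simp add: pos_divide_le_eq mult.commute)
    qed
    then have "lam * (v \<bullet> v) / r \<le> (\<integral>\<omega>. v \<bullet> (A \<omega> *v v) \<partial>M)"
      using int_Av[of v] by (intro integral_ge_const) auto
    also have "\<dots> = v \<bullet> ((\<integral>\<omega>. A \<omega> \<partial>M) *v v)"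
      using int_Av[of v] by (simp add: integral_Av[symmetric])
    finally show "0 < v \<bullet> ((\<integral>\<omega>. A \<omega> \<partial>M) *v v)"
      using lam \<open>v \<noteq> 0\<close> by (auto intro: less_le_trans[rotated])
  qed

  have R_G: "(\<lambda>\<omega>. R \<omega> $ e $ k) \<in> borel_measurable G" for e k
    unfolding R_def by (rule borel_measurable_matrix_mult_component[OF Zb])
  \<comment> \<open>A diagonal entry of \<open>A\<close> is the sum of squares of a column of
    \<open>R\<close>, and \<open>\<bar>x\<bar>\<close> is at most \<open>1 + x * x\<close>.\<close>
  have int_R: "integrable M (\<lambda>\<omega>. R \<omega> $ e $ k)" for e k
  proof (rule Bochner_Integration.integrable_bound)
    show "integrable M (\<lambda>\<omega>. 1 + A \<omega> $ k $ k)"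
      using int_A_nth by simp
    show "(\<lambda>\<omega>. R \<omega> $ e $ k) \<in> borel_measurable M"
      by (rule measurable_from_subalg[OF subalg R_G])
    have "\<bar>R \<omega> $ e $ k\<bar> \<le> 1 + A \<omega> $ k $ k" for \<omega>
    proof -
      have "(R \<omega> $ e $ k)\<^sup>2 \<le> (\<Sum>i\<in>UNIV. (R \<omega> $ i $ k)\<^sup>2)"
        by (rule member_le_sum) auto
      also have "\<dots> = A \<omega> $ k $ k"
        by (simp add: A_R matrix_matrix_mult_def transpose_def power2_eq_square)
      finally show ?thesis
        using sum_power2_ge_zero[of "\<bar>R \<omega> $ e $ k\<bar> - 1" 0] by (simp add: power2_diff)
    qed
    then show "AE \<omega> in M. norm (R \<omega> $ e $ k) \<le> norm (1 + A \<omega> $ k $ k)"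
      by (intro AE_I2) (simp add: order_trans[OF _ abs_ge_self])
  qed
  note weighted_R = weighted[OF R_G int_R]
  have RtY: "((transpose (Zb \<omega>) ** D) *v y) $ k = (\<Sum>e\<in>UNIV. R \<omega> $ e $ k * y $ e)" for \<omega> y k
    unfolding ZD by (simp add: matrix_vector_mult_def transpose_def)
  show int_ZDY: "integrable M (\<lambda>\<omega>. (transpose (Zb \<omega>) ** D) *v Yb \<omega>)"
    by (rule integrable_vec) (simp add: RtY weighted_R)
  have "(\<integral>\<omega>. (transpose (Zb \<omega>) ** D) *v Yb \<omega> \<partial>M) $ k = ((\<integral>\<omega>. A \<omega> \<partial>M) *v \<eta>) $ k" for k
  proof -
    have "(\<integral>\<omega>. (transpose (Zb \<omega>) ** D) *v Yb \<omega> \<partial>M) $ k = (\<Sum>e\<in>UNIV. \<integral>\<omega>. R \<omega> $ e $ k * Yb \<omega> $ e \<partial>M)"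
      by (simp add: integral_vec_nth[OF int_ZDY] RtY weighted_R)
    also have "\<dots> = (\<Sum>e\<in>UNIV. \<integral>\<omega>. R \<omega> $ e $ k * (c + Zb \<omega> *v \<eta>) $ e \<partial>M)"
      using weighted_R by (intro sum.cong) blast+
    also have "\<dots> = (\<integral>\<omega>. (\<Sum>e\<in>UNIV. R \<omega> $ e $ k * (c + Zb \<omega> *v \<eta>) $ e) \<partial>M)"
      using weighted_R by (intro Bochner_Integration.integral_sum[symmetric]) blast
    also have "\<dots> = (\<integral>\<omega>. (A \<omega> *v \<eta>) $ k \<partial>M)"
    proof -
      \<comment> \<open>Here the term \<open>c\<close> disappears, as \<open>D\<close> annihilates
        it.\<close>
      have "(transpose (Zb \<omega>) ** D) *v (c + Zb \<omega> *v \<eta>) = A \<omega> *v \<eta>" for \<omega>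
        by (simp add: A_def matrix_vector_right_distrib matrix_vector_mul_assoc[symmetric] Dc)
      then show ?thesis
        by (simp only: RtY[symmetric])
    qed
    also have "\<dots> = ((\<integral>\<omega>. A \<omega> \<partial>M) *v \<eta>) $ k"
      by (simp add: integral_vec_nth[OF int_Av, symmetric] integral_Av)
    finally show ?thesis .
  qed
  then have "(\<integral>\<omega>. (transpose (Zb \<omega>) ** D) *v Yb \<omega> \<partial>M) = (\<integral>\<omega>. A \<omega> \<partial>M) *v \<eta>"
    by (simp add: vec_eq_iff)
  then show "\<eta> = matrix_inv (\<integral>\<omega>. A \<omega> \<partial>M) *v (\<integral>\<omega>. (transpose (Zb \<omega>) ** D) *v Yb \<omega> \<partial>M)"
    by (simp add: matrix_vector_mul_assoc matrix_inv_left_right[OF inv])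
qed

section \<open>Identification in the paired-comparison model\<close>

lemma measurable_generated_algebra:
  assumes "c \<in> I"
  shows "W c \<in> borel_measurable (generated_algebra M I W)"
proof -
  have "(\<lambda>\<omega>. \<lambda>c\<in>I. W c \<omega>) \<in> measurable (generated_algebra M I W) (\<Pi>\<^sub>M c\<in>I. borel)"
    unfolding generated_algebra_def by (rule measurable_vimage_algebra1) (auto simp: space_PiM)
  from measurable_compose[OF this measurable_component_singleton[OF assms]]
  show ?thesis using assms by simp
qed

lemma subalgebra_generated_algebra:
  assumes "\<And>c. c \<in> I \<Longrightarrow> W c \<in> borel_measurable M"
  shows "subalgebra M (generated_algebra M I W)"
  unfolding subalgebra_def generated_algebra_def
  by (simp add: sets_vimage_algebra_subset measurable_restrict assms)

lemma sets_vimage_algebra_compose: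
  assumes "g \<in> measurable N N'" and "X \<in> S \<rightarrow> space N"
  shows "sets (vimage_algebra S (\<lambda>\<omega>. g (X \<omega>)) N') \<subseteq> sets (vimage_algebra S X N)"
  using sets_vimage_algebra_subset[OF measurable_compose[OF measurable_vimage_algebra1[OF assms(2)] assms(1)]]
  by simp

lemma (in prob_space) indep_set_mono:
  assumes "indep_set A B" and "B' \<subseteq> B"
  shows "indep_set A B'"
  using assms(1) unfolding indep_set_def
  by (rule indep_sets_mono_sets) (use assms(2) in \<open>auto split: bool.split\<close>)

lemma tail_measurable: "tail \<in> borel_measurable borel"
  unfolding tail_def by (intro borel_measurable_continuous_onI continuous_intros continuous_on_vec_lambda)

lemma inner_option: "x \<bullet> y = x $ None * y $ None + tail x \<bullet> tail y"
  by (simp add: inner_vec_def tail_def UNIV_option_conv sum.reindex)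

text \<open>Item \<open>0\<close> has the zero vector as \<open>unit_vec\<close>, so the formula
  holds for its pairs exactly because its merit is normalised to \<open>0\<close>.\<close>

lemma U_mat_mult:
  assumes "\<theta> None = 0"
  shows "(U_mat *v (\<chi> i. \<theta> (Some i))) $ e = \<theta> (lo e) - \<theta> (hi e)"
proof -
  have "unit_vec i \<bullet> (\<chi> i. \<theta> (Some i)) = \<theta> i" for i
    using assms by (cases i) (simp_all add: unit_vec_def inner_axis')
  then show ?thesis
    by (simp add: matrix_vector_mul_component U_mat_def inner_diff_left)
qed

theorem corollary1:
  fixes M :: "'a measure" and T :: nat
    and \<theta> :: "'n::{finite,linorder} option \<Rightarrow> real"
    and \<gamma> :: "real^('p::finite option)"
    and X :: "'n option \<Rightarrow> 'n option \<Rightarrow> nat \<Rightarrow> 'a \<Rightarrow> real^('p option)"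
    and \<epsilon> :: "'n option \<Rightarrow> 'n option \<Rightarrow> nat \<Rightarrow> 'a \<Rightarrow> real"
    and F :: "real \<Rightarrow> real"
    and f :: "'n option \<Rightarrow> 'n option \<Rightarrow> nat \<Rightarrow> real \<Rightarrow> real^'p \<Rightarrow> real"
    and B lam :: real
  defines "Z \<equiv> \<lambda>i j t \<omega>. tail (X i j t \<omega>)"
    and "\<eta> \<equiv> tail \<gamma>"
    and "a \<equiv> outcome \<theta> \<gamma> X \<epsilon>"
  defines "Zbar \<equiv> pair_average T Z"
    and "Ybar \<equiv> pair_average T (transformed a X f)"
  assumes "prob_space M" and "T > 0"
    \<comment> \<open>model\<close>
    and "\<And>i j t. i \<noteq> j \<Longrightarrow> t \<in> {1..T} \<Longrightarrow> X i j t \<in> borel_measurable M"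
    and "\<And>i j t. i \<noteq> j \<Longrightarrow> t \<in> {1..T} \<Longrightarrow> \<epsilon> i j t \<in> borel_measurable M"
    and "\<And>i j t \<omega>. i \<noteq> j \<Longrightarrow> t \<in> {1..T} \<Longrightarrow> \<omega> \<in> space M \<Longrightarrow> X i j t \<omega> = - X j i t \<omega>"
    and "\<And>i j t. i \<noteq> j \<Longrightarrow> t \<in> {1..T} \<Longrightarrow> cdf (distr M borel (\<epsilon> i j t)) = F"
    and "\<And>x. F x + F (- x) = 1"
    and "cond_indep_vars M (generated_algebra M (comparisons T) (\<lambda>(i, j, t). X i j t)) borel
           (\<lambda>(i, j, t). a i j t) (comparisons T)"
    \<comment> \<open>C1\<close>
    and "\<gamma> $ None > 0"
    and "\<And>i j t. i < j \<Longrightarrow> t \<in> {1..T} \<Longrightarrow>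
           cond_density M (\<lambda>\<omega>. X i j t \<omega> $ None) (Z i j t) borel (f i j t)"
    \<comment> \<open>C2\<close>
    and "B > 0"
    and "\<And>i j t. i < j \<Longrightarrow> t \<in> {1..T} \<Longrightarrow>
           AE \<omega> in M. support_on UNIV (\<lambda>x. f i j t x (Z i j t \<omega>)) = {-B<..<B}"
    and "\<And>i j t. i < j \<Longrightarrow> t \<in> {1..T} \<Longrightarrow>
           AE \<omega> in M. - (\<theta> i - \<theta> j + Z i j t \<omega> \<bullet> \<eta> - \<epsilon> i j t \<omega>) / \<gamma> $ None \<in> {-B<..<B}"
    \<comment> \<open>C3\<close>
    and "\<And>i j t. i < j \<Longrightarrow> t \<in> {1..T} \<Longrightarrow>
           prob_space.indep_set M (sets (vimage_algebra (space M) (\<epsilon> i j t) borel))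
             (sets (vimage_algebra (space M) (X i j t) borel))"
    and "\<And>i j t \<omega>. i < j \<Longrightarrow> t \<in> {1..T} \<Longrightarrow> \<omega> \<in> space M \<Longrightarrow> \<epsilon> i j t \<omega> = - \<epsilon> j i t \<omega>"
    and "\<And>i j t. i < j \<Longrightarrow> t \<in> {1..T} \<Longrightarrow> has_bochner_integral M (\<epsilon> i j t) 0"
    \<comment> \<open>C4\<close>
    and "lam > 0"
    and "AE \<omega> in M. lambda_min ((1 / real CARD('n pairs)) *\<^sub>R
           (transpose (Zbar \<omega>) ** D_mat ** Zbar \<omega>)) \<ge> lam"
    \<comment> \<open>normalisation\<close>
    and "\<gamma> $ None = 1" and "\<theta> None = 0"
  shows "invertible (V_mat :: real^('n::{finite,linorder})^('n::{finite,linorder})) \<and>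
    integrable M (\<lambda>\<omega>. Ybar \<omega> - Zbar \<omega> *v \<eta>) \<and>
    (\<chi> i. \<theta> (Some i)) =
      (matrix_inv V_mat ** transpose U_mat) *v (\<integral>\<omega>. (Ybar \<omega> - Zbar \<omega> *v \<eta>) \<partial>M) \<and>
    \<comment> \<open>Second identity: \<open>Z\<close> is exogenous across comparisons, and \<open>E(Zbar' D Zbar)\<close> exists.
      Neither follows from C1--C4, and both are needed.\<close>
    ((\<forall>i j t. i < j \<longrightarrow> t \<in> {1..T} \<longrightarrow>
        cond_law_reduces M (generated_algebra M (comparisons T) (\<lambda>(i, j, t). Z i j t))
          (vimage_algebra (space M) (Z i j t) borel)
          (\<lambda>\<omega>. (X i j t \<omega> $ None, \<epsilon> i j t \<omega>)) borel) \<longrightarrow>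
     integrable M (\<lambda>\<omega>. transpose (Zbar \<omega>) ** D_mat ** Zbar \<omega>) \<longrightarrow>
     invertible (\<integral>\<omega>. transpose (Zbar \<omega>) ** D_mat ** Zbar \<omega> \<partial>M) \<and>
     integrable M (\<lambda>\<omega>. (transpose (Zbar \<omega>) ** D_mat) *v Ybar \<omega>) \<and>
     \<eta> = matrix_inv (\<integral>\<omega>. transpose (Zbar \<omega>) ** D_mat ** Zbar \<omega> \<partial>M) *v
           (\<integral>\<omega>. (transpose (Zbar \<omega>) ** D_mat) *v Ybar \<omega> \<partial>M))"
proof -
  interpret prob_space M by (rule assms(6))
  note T_pos = assms(7) and \<gamma>_None = assms(24) and \<theta>_None = assms(25)
  let ?m = "\<lambda>i j z. \<theta> i - \<theta> j + z \<bullet> \<eta>"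
  define Y where "Y = transformed a X f"
  have X_meas: "X i j t \<in> borel_measurable M" if "i < j" "t \<in> {1..T}" for i j t
    by (rule assms(8)) (use that in auto)
  have Z_meas: "Z i j t \<in> borel_measurable M" if "i < j" "t \<in> {1..T}" for i j t
    unfolding Z_def by (rule measurable_compose[OF X_meas[OF that] tail_measurable])

  \<comment> \<open>Each comparison as an instance of the threshold model\<close>
  have comparison: "threshold_comparison M G borel (\<lambda>\<omega>. X i j t \<omega> $ None) (\<epsilon> i j t) (Z i j t) (f i j t) (?m i j) B"
    if "i < j" "t \<in> {1..T}" and G: "subalgebra M G" "Z i j t \<in> borel_measurable G"
      "cond_law_reduces M G (vimage_algebra (space M) (Z i j t) borel) (\<lambda>\<omega>. (X i j t \<omega> $ None, \<epsilon> i j t \<omega>)) borel"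
    for G i j t
  proof unfold_locales
    note ij = that(1,2)
    show "subalgebra M G" "Z i j t \<in> borel_measurable G"
      "cond_law_reduces M G (vimage_algebra (space M) (Z i j t) borel) (\<lambda>\<omega>. (X i j t \<omega> $ None, \<epsilon> i j t \<omega>)) borel"
      by fact+
    show "\<epsilon> i j t \<in> borel_measurable M"
      by (rule assms(9)) (use ij in auto)
    show "cond_density M (\<lambda>\<omega>. X i j t \<omega> $ None) (Z i j t) borel (f i j t)"
      by (rule assms(15)[OF ij])
    \<comment> \<open>C3 concerns the whole covariate vector. The pair of its tail and component
      \<open>0\<close> is a measurable function of it, so independence passes to the smaller
      algebra.\<close>
    have "(\<lambda>x :: real^('p option). x $ None) \<in> borel_measurable borel"
      by (intro borel_measurable_continuous_onI continuous_intros)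
    then have "(\<lambda>x :: real^('p option). (tail x, x $ None)) \<in> borel \<rightarrow>\<^sub>M borel \<Otimes>\<^sub>M borel"
      using tail_measurable by measurable
    from indep_set_mono[OF assms(19)[OF ij] sets_vimage_algebra_compose[OF this, of "X i j t"]]
    show "indep_set (sets (vimage_algebra (space M) (\<epsilon> i j t) borel))
        (sets (vimage_algebra (space M) (\<lambda>\<omega>. (Z i j t \<omega>, X i j t \<omega> $ None)) (borel \<Otimes>\<^sub>M borel)))"
      by (simp add: Z_def)
    show "?m i j \<in> borel_measurable borel"
      by measurable
    show "AE \<omega> in M. support_on UNIV (\<lambda>x. f i j t x (Z i j t \<omega>)) = {-B<..<B}"
      by (rule assms(17)[OF ij])
    show "AE \<omega> in M. \<bar>?m i j (Z i j t \<omega>) - \<epsilon> i j t \<omega>\<bar> < B"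
      using assms(18)[OF ij] by eventually_elim (auto simp: \<gamma>_None)
    show "has_bochner_integral M (\<epsilon> i j t) 0"
      by (rule assms(21)[OF ij])
  qed
  have Y_eq: "threshold_comparison.Y (\<lambda>\<omega>. X i j t \<omega> $ None) (\<epsilon> i j t) (Z i j t) (f i j t) (?m i j) = Y i j t"
    if "threshold_comparison M G borel (\<lambda>\<omega>. X i j t \<omega> $ None) (\<epsilon> i j t) (Z i j t) (f i j t) (?m i j) B" for G i j t
  proof -
    have "(\<epsilon> i j t \<omega> - ?m i j (Z i j t \<omega>) < X i j t \<omega> $ None) = (\<epsilon> i j t \<omega> < \<theta> i - \<theta> j + X i j t \<omega> \<bullet> \<gamma>)" for \<omega>
      by (auto simp: inner_option[of _ \<gamma>] \<gamma>_None Z_def \<eta>_def)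
    then show ?thesis
      unfolding fun_eq_iff threshold_comparison.Y_def[OF that]
      by (simp add: Y_def transformed_def a_def outcome_def Z_def)
  qed

  \<comment> \<open>Unconditional means and the identity for the merits\<close>
  have mean: "integrable M (Y i j t) \<and> integrable M (\<lambda>\<omega>. Z i j t \<omega> \<bullet> \<eta>) \<and>
      (\<integral>\<omega>. Y i j t \<omega> \<partial>M) = \<theta> i - \<theta> j + (\<integral>\<omega>. Z i j t \<omega> \<bullet> \<eta> \<partial>M)" if ij: "i < j" "t \<in> {1..T}" for i j t
  proof -
    let ?H = "vimage_algebra (space M) (Z i j t) borel"
    \<comment> \<open>With the algebra of \<open>Z i j t\<close> itself as \<open>G\<close>, the
      reduction condition compares a conditional expectation with itself.\<close>
    have tc: "threshold_comparison M ?H borel (\<lambda>\<omega>. X i j t \<omega> $ None) (\<epsilon> i j t) (Z i j t) (f i j t) (?m i j) B"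
      by (rule comparison[OF ij])
        (auto simp: cond_law_reduces_def subalgebra_def sets_vimage_algebra_subset[OF Z_meas[OF ij]] intro: measurable_vimage_algebra1)
    have "integrable M (\<lambda>\<omega>. ?m i j (Z i j t \<omega>) - (\<theta> i - \<theta> j))"
      using threshold_comparison.integrable_mZ[OF tc] by (rule Bochner_Integration.integrable_diff) simp
    then have "integrable M (\<lambda>\<omega>. Z i j t \<omega> \<bullet> \<eta>)" by simp
    then show ?thesis
      using threshold_comparison.integrable_Y[OF tc] threshold_comparison.expectation_Y[OF tc]
      by (simp add: Y_eq[OF tc] prob_space)
  qed

  let ?\<theta> = "\<chi> i. \<theta> (Some i)"
  have Zbar_nth: "(Zbar \<omega> *v \<eta>) $ e = (\<Sum>t=1..T. Z (lo e) (hi e) t \<omega> \<bullet> \<eta>) / T" for \<omega> e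
    by (simp add: matrix_vector_mul_component Zbar_def pair_average_def inner_sum_left)
  have Ybar_nth: "Ybar \<omega> $ e = (\<Sum>t=1..T. Y (lo e) (hi e) t \<omega>) / T" for \<omega> e
    by (simp add: Ybar_def pair_average_def Y_def)
  have \<theta>_nth: "(U_mat *v ?\<theta>) $ e = \<theta> (lo e) - \<theta> (hi e)" for e
    by (rule U_mat_mult[of \<theta>, OF \<theta>_None])

  have diff_nth: "integrable M (\<lambda>\<omega>. (Ybar \<omega> - Zbar \<omega> *v \<eta>) $ e) \<and>
      (\<integral>\<omega>. (Ybar \<omega> - Zbar \<omega> *v \<eta>) $ e \<partial>M) = (U_mat *v ?\<theta>) $ e" for e
  proof -
    let ?g = "\<lambda>t \<omega>. Y (lo e) (hi e) t \<omega> - Z (lo e) (hi e) t \<omega> \<bullet> \<eta>"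
    have g: "integrable M (?g t)" "(\<integral>\<omega>. ?g t \<omega> \<partial>M) = \<theta> (lo e) - \<theta> (hi e)" if "t \<in> {1..T}" for t
      using mean[OF lo_less_hi[of e] that] by simp_all
    have "(Ybar \<omega> - Zbar \<omega> *v \<eta>) $ e = (\<Sum>t=1..T. ?g t \<omega>) / T" for \<omega>
      by (simp add: Zbar_nth Ybar_nth sum_subtractf diff_divide_distrib)
    moreover have "integrable M (\<lambda>\<omega>. \<Sum>t=1..T. ?g t \<omega>)"
      using g by (intro Bochner_Integration.integrable_sum) blast
    moreover have "(\<integral>\<omega>. (\<Sum>t=1..T. ?g t \<omega>) \<partial>M) = (\<Sum>t=1..T. \<integral>\<omega>. ?g t \<omega> \<partial>M)"
      using g by (intro Bochner_Integration.integral_sum) blast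
    moreover have "\<dots> = T * (\<theta> (lo e) - \<theta> (hi e))"
      using g by simp
    ultimately show ?thesis
      using T_pos by (simp add: \<theta>_nth)
  qed
  have integrable_diff: "integrable M (\<lambda>\<omega>. Ybar \<omega> - Zbar \<omega> *v \<eta>)"
    by (rule integrable_vec) (use diff_nth in blast)
  have "(\<integral>\<omega>. Ybar \<omega> - Zbar \<omega> *v \<eta> \<partial>M) = U_mat *v ?\<theta>"
    unfolding vec_eq_iff integral_vec_nth[OF integrable_diff] using diff_nth by blast
  then have first: "?\<theta> = (matrix_inv V_mat ** transpose U_mat) *v (\<integral>\<omega>. (Ybar \<omega> - Zbar \<omega> *v \<eta>) \<partial>M)"
    by (simp add: matrix_vector_mul_assoc V_mat_inv_U)

  \<comment> \<open>Conditioning on all covariates and the identity for the coefficients\<close>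
  have second: "invertible (\<integral>\<omega>. transpose (Zbar \<omega>) ** D_mat ** Zbar \<omega> \<partial>M)"
    "integrable M (\<lambda>\<omega>. (transpose (Zbar \<omega>) ** D_mat) *v Ybar \<omega>)"
    "\<eta> = matrix_inv (\<integral>\<omega>. transpose (Zbar \<omega>) ** D_mat ** Zbar \<omega> \<partial>M) *v
         (\<integral>\<omega>. (transpose (Zbar \<omega>) ** D_mat) *v Ybar \<omega> \<partial>M)"
    if exogenous: "\<forall>i j t. i < j \<longrightarrow> t \<in> {1..T} \<longrightarrow>
        cond_law_reduces M (generated_algebra M (comparisons T) (\<lambda>(i, j, t). Z i j t))
          (vimage_algebra (space M) (Z i j t) borel) (\<lambda>\<omega>. (X i j t \<omega> $ None, \<epsilon> i j t \<omega>)) borel"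
      and int: "integrable M (\<lambda>\<omega>. transpose (Zbar \<omega>) ** D_mat ** Zbar \<omega>)"
  proof -
    \<comment> \<open>An entry of \<open>D_mat ** Zbar \<omega>\<close> mixes the covariates of all
      pairs, so the weights are measurable only for the algebra generated jointly by all of
      them.\<close>
    define G where "G = generated_algebra M (comparisons T) (\<lambda>(i, j, t). Z i j t)"
    have subalg: "subalgebra M G"
      unfolding G_def by (rule subalgebra_generated_algebra) (auto simp: comparisons_def intro!: Z_meas)
    have Z_G: "Z i j t \<in> borel_measurable G" if "i < j" "t \<in> {1..T}" for i j t
      using measurable_generated_algebra[of "(i, j, t)" "comparisons T" "\<lambda>(i, j, t). Z i j t" M] that
      by (simp add: G_def comparisons_def)
    have weighted: "integrable M (\<lambda>\<omega>. q \<omega> * Y i j t \<omega>) \<and> integrable M (\<lambda>\<omega>. q \<omega> * ?m i j (Z i j t \<omega>)) \<and>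
        (\<integral>\<omega>. q \<omega> * Y i j t \<omega> \<partial>M) = (\<integral>\<omega>. q \<omega> * ?m i j (Z i j t \<omega>) \<partial>M)"
      if ij: "i < j" "t \<in> {1..T}" and q: "q \<in> borel_measurable G" "integrable M q" for i j t and q :: "'a \<Rightarrow> real"
    proof -
      have tc: "threshold_comparison M G borel (\<lambda>\<omega>. X i j t \<omega> $ None) (\<epsilon> i j t) (Z i j t) (f i j t) (?m i j) B"
        by (rule comparison[OF ij subalg Z_G[OF ij]]) (use exogenous ij in \<open>auto simp: G_def\<close>)
      show ?thesis
        using threshold_comparison.integrable_weighted_Y[OF tc q] threshold_comparison.integrable_weighted_mZ[OF tc q]
          threshold_comparison.expectation_weighted_Y[OF tc q] by (simp only: Y_eq[OF tc])
    qed
    have weighted_bar: "integrable M (\<lambda>\<omega>. q \<omega> * Ybar \<omega> $ e) \<and>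
        integrable M (\<lambda>\<omega>. q \<omega> * (U_mat *v ?\<theta> + Zbar \<omega> *v \<eta>) $ e) \<and>
        (\<integral>\<omega>. q \<omega> * Ybar \<omega> $ e \<partial>M) = (\<integral>\<omega>. q \<omega> * (U_mat *v ?\<theta> + Zbar \<omega> *v \<eta>) $ e \<partial>M)"
      if q: "q \<in> borel_measurable G" "integrable M q" for q :: "'a \<Rightarrow> real" and e
    proof -
      note w = weighted[OF lo_less_hi _ q]
      have 1: "q \<omega> * Ybar \<omega> $ e = (\<Sum>t=1..T. q \<omega> * Y (lo e) (hi e) t \<omega>) / T" for \<omega>
        by (simp add: Ybar_nth sum_distrib_left)
      have 2: "q \<omega> * (U_mat *v ?\<theta> + Zbar \<omega> *v \<eta>) $ e = (\<Sum>t=1..T. q \<omega> * ?m (lo e) (hi e) (Z (lo e) (hi e) t \<omega>)) / T" for \<omega>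
        using T_pos by (simp add: Zbar_nth \<theta>_nth sum_distrib_left[symmetric] sum.distrib) (simp add: field_simps)
      have "integrable M (\<lambda>\<omega>. \<Sum>t=1..T. q \<omega> * Y (lo e) (hi e) t \<omega>)"
        "integrable M (\<lambda>\<omega>. \<Sum>t=1..T. q \<omega> * ?m (lo e) (hi e) (Z (lo e) (hi e) t \<omega>))"
        by (rule Bochner_Integration.integrable_sum, use w in blast)+
      moreover have "(\<integral>\<omega>. (\<Sum>t=1..T. q \<omega> * Y (lo e) (hi e) t \<omega>) \<partial>M) = (\<Sum>t=1..T. \<integral>\<omega>. q \<omega> * Y (lo e) (hi e) t \<omega> \<partial>M)"
        by (rule Bochner_Integration.integral_sum) (use w in blast)
      moreover have "\<dots> = (\<Sum>t=1..T. \<integral>\<omega>. q \<omega> * ?m (lo e) (hi e) (Z (lo e) (hi e) t \<omega>) \<partial>M)"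
        by (rule sum.cong) (use w in blast)+
      moreover have "\<dots> = (\<integral>\<omega>. (\<Sum>t=1..T. q \<omega> * ?m (lo e) (hi e) (Z (lo e) (hi e) t \<omega>)) \<partial>M)"
        by (rule Bochner_Integration.integral_sum[symmetric]) (use w in blast)
      ultimately show ?thesis
        unfolding 1 2 by simp
    qed
    have DU: "D_mat *v (U_mat *v ?\<theta>) = 0"
      by (simp add: matrix_vector_mul_assoc D_mat_U)
    have Zbar_G: "(\<lambda>\<omega>. Zbar \<omega> $ e $ k) \<in> borel_measurable G" for e k
    proof -
      have "(\<lambda>z :: real^'p. z $ k) \<in> borel_measurable borel"
        by (intro borel_measurable_continuous_onI continuous_intros)
      then have "(\<lambda>\<omega>. Z (lo e) (hi e) t \<omega> $ k) \<in> borel_measurable G" if "t \<in> {1..T}" for t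
        by (rule measurable_compose[OF Z_G[OF lo_less_hi that]])
      then show ?thesis
        unfolding Zbar_def pair_average_def by simp
    qed
    \<comment> \<open>The scaling \<open>1 / N\<close> in C4 serves as \<open>r\<close> in
      \<open>normal_equations\<close>.\<close>
    have N_pos: "0 < 1 / real CARD('n pairs)"
      by simp
    note ne = normal_equations[OF assms(6) subalg D_mat_idem DU Zbar_G int weighted_bar assms(22) N_pos assms(23)]
    show "invertible (\<integral>\<omega>. transpose (Zbar \<omega>) ** D_mat ** Zbar \<omega> \<partial>M)"
      by (rule ne(1))
    show "integrable M (\<lambda>\<omega>. (transpose (Zbar \<omega>) ** D_mat) *v Ybar \<omega>)"
      by (rule ne(2))
    show "\<eta> = matrix_inv (\<integral>\<omega>. transpose (Zbar \<omega>) ** D_mat ** Zbar \<omega> \<partial>M) *v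
         (\<integral>\<omega>. (transpose (Zbar \<omega>) ** D_mat) *v Ybar \<omega> \<partial>M)"
      by (rule ne(3))
  qed
  show ?thesis
    using invertible_V_mat integrable_diff first second by blast
qed

end
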